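(* Let $\Omega=\prod_{i=1}^n\Omega_i$ be the product group of abelian groups $\Omega_i$, where either all $\Omega_i$ are finitely generated abelian groups or all $\Omega_i$ are vector spaces over a common infinite field $\mathbbm k$. For each $i$ let $\mathscr L(\Omega_i)$ be the intersectional class generated by the cosets of all subgroups of $\Omega_i$ and $\mathscr B(\Omega_i)$ the Boolean algebra generated by $\mathscr L(\Omega_i)$; let $\prod_{i=1}^n\mathscr B(\Omega_i)$ be the Boolean algebra of subsets of $\Omega$ generated by all products $\prod_{i=1}^n A_i$ with $A_i$ a coset of a subgroup of $\Omega_i$. Then there exists a unique translation-invariant valuation \[ \lambda:\prod_{i=1}^n\mathscr B(\Omega_i)\to\mathbb Q[t_1,\ldots,t_n] \] such that for all subgroups $A_i$ of $\Omega_i$, \[ \lambda\Big(\prod_{i=1}^n A_i\Big)=\prod_{i=1}^n\frac{|\mathrm{Tor}(\Omega_i)|}{|\mathrm{Tor}(\Omega_i/A_i)|}\,t_i^{\operatorname{rank}(A_i)}. \]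
   Context: In the vector space case, "subgroup" means $\mathbbm k$-linear subspace, rank means dimension, and all torsion subgroups are trivial. $\mathrm{Tor}(\Gamma)$ is the torsion subgroup of an abelian group $\Gamma$ (elements of finite order) and $|\mathrm{Tor}(\Gamma)|$ its cardinality. A valuation is a map $\lambda$ on the Boolean algebra with $\lambda(\emptyset)=0$ and $\lambda(S\cup S')+\lambda(S\cap S')=\lambda(S)+\lambda(S')$; translation-invariant means $\lambda(S+\omega)=\lambda(S)$ for all $\omega\in\Omega$.
   Formalization: In the vector space case the spaces are assumed finite-dimensional; otherwise the prescribed value at A_i = Ω_i would involve t_i to an infinite power, which is not a polynomial. *)

theory Defs
  imports
    "HOL-Algebra.Product_Groups"
    "HOL-Algebra.Generated_Groups"
    "HOL-Library.Poly_Mapping"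
    "Jordan_Normal_Form.Missing_VectorSpace"
begin

definition finitely_generated :: "('a, 'b) monoid_scheme \<Rightarrow> bool" where
  "finitely_generated G \<longleftrightarrow> (\<exists>S. finite S \<and> S \<subseteq> carrier G \<and> generate G S = carrier G)"

definition Tor :: "('a, 'b) monoid_scheme \<Rightarrow> 'a set" where
  "Tor G = {x \<in> carrier G. \<exists>m::nat. m > 0 \<and> x [^]\<^bsub>G\<^esub> m = \<one>\<^bsub>G\<^esub>}"

definition int_independent :: "('a, 'b) monoid_scheme \<Rightarrow> 'a set \<Rightarrow> bool" where
  "int_independent G S \<longleftrightarrow>
     (\<forall>c :: 'a \<Rightarrow> int. (\<Otimes>\<^bsub>G\<^esub>x\<in>S. x [^]\<^bsub>G\<^esub> c x) = \<one>\<^bsub>G\<^esub> \<longrightarrow> (\<forall>x\<in>S. c x = 0))"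

text \<open>The supremum is a genuine maximum whenever \<open>G\<close> is a subgroup of a finitely generated
  abelian group, since the cardinalities of independent sets are then bounded.\<close>

definition group_rank :: "('a, 'b) monoid_scheme \<Rightarrow> nat" where
  "group_rank G = Sup {card S | S. finite S \<and> S \<subseteq> carrier G \<and> int_independent G S}"

text \<open>Polynomials in countably many indeterminates over the rationals: a monomial is a finitely
  supported exponent function \<open>nat \<Rightarrow>\<^sub>0 nat\<close>, and multiplication is the convolution
  product of \<open>Poly_Mapping\<close>. The ring in the indeterminates 1, ..., n is a subset of it.\<close>

type_synonym rat_mpoly = "(nat \<Rightarrow>\<^sub>0 nat) \<Rightarrow>\<^sub>0 rat"

definition Const :: "rat \<Rightarrow> rat_mpoly" where
  "Const c = Poly_Mapping.single 0 c"

definition Var :: "nat \<Rightarrow> rat_mpoly" where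
  "Var i = Poly_Mapping.single (Poly_Mapping.single i 1) 1"

definition rat_polys :: "nat \<Rightarrow> rat_mpoly set" where
  "rat_polys n = {p. \<forall>m \<in> Poly_Mapping.keys p. Poly_Mapping.keys m \<subseteq> {1..n}}"

inductive_set generated_boolean_algebra :: "'a set \<Rightarrow> 'a set set \<Rightarrow> 'a set set"
  for X :: "'a set" and \<G> :: "'a set set" where
  generator: "S \<in> \<G> \<Longrightarrow> S \<in> generated_boolean_algebra X \<G>"
| empty: "{} \<in> generated_boolean_algebra X \<G>"
| compl: "S \<in> generated_boolean_algebra X \<G> \<Longrightarrow> X - S \<in> generated_boolean_algebra X \<G>"
| union: "S \<in> generated_boolean_algebra X \<G> \<Longrightarrow> T \<in> generated_boolean_algebra X \<G> \<Longrightarrow>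
    S \<union> T \<in> generated_boolean_algebra X \<G>"

text \<open>\<open>Sub i\<close> is the collection of admissible subgroups of \<open>\<Omega> i\<close>: all subgroups in the case of
  finitely generated abelian groups, the linear subspaces in the case of vector spaces.\<close>

definition coset_product_algebra ::
  "nat \<Rightarrow> (nat \<Rightarrow> ('a, 'b) monoid_scheme) \<Rightarrow> (nat \<Rightarrow> 'a set set) \<Rightarrow> (nat \<Rightarrow> 'a) set set" where
  "coset_product_algebra n \<Omega> Sub =
     generated_boolean_algebra (carrier (product_group {1..n} \<Omega>))
       {\<Pi>\<^sub>E i\<in>{1..n}. C i | C. \<forall>i\<in>{1..n}. \<exists>A\<in>Sub i. C i \<in> rcosets\<^bsub>\<Omega> i\<^esub> A}"

definition valuation_on :: "'a set set \<Rightarrow> ('a set \<Rightarrow> 'r::comm_monoid_add) \<Rightarrow> bool" where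
  "valuation_on \<B> f \<longleftrightarrow>
     f {} = 0 \<and> (\<forall>S\<in>\<B>. \<forall>T\<in>\<B>. f (S \<union> T) + f (S \<inter> T) = f S + f T)"

definition translation_invariant_on ::
  "('a, 'b) monoid_scheme \<Rightarrow> 'a set set \<Rightarrow> ('a set \<Rightarrow> 'r) \<Rightarrow> bool" where
  "translation_invariant_on G \<B> f \<longleftrightarrow> (\<forall>S\<in>\<B>. \<forall>w\<in>carrier G. f (S #>\<^bsub>G\<^esub> w) = f S)"

definition fg_product_algebra ::
  "nat \<Rightarrow> (nat \<Rightarrow> ('a, 'b) monoid_scheme) \<Rightarrow> (nat \<Rightarrow> 'a) set set" where
  "fg_product_algebra n \<Omega> = coset_product_algebra n \<Omega> (\<lambda>i. {A. subgroup A (\<Omega> i)})"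

definition vs_product_algebra ::
  "nat \<Rightarrow> ('k, 'c) ring_scheme \<Rightarrow> (nat \<Rightarrow> ('k, 'a, 'd) module_scheme) \<Rightarrow> (nat \<Rightarrow> 'a) set set" where
  "vs_product_algebra n K V =
     coset_product_algebra n (\<lambda>i. add_monoid (V i)) (\<lambda>i. {A. VectorSpace.subspace K A (V i)})"

end

(* By Groemer's extension criterion it suffices to see that every linear relation between indicator
   functions of products of cosets is respected by the prescribed values. With coefficients allowed
   in the polynomial ring this can be checked one coordinate at a time, so it reduces to a relation
   between cosets in a single group. There the weights of two admissible subgroups B \<subseteq> A with B of
   finite index satisfy weight A = [A : B] * weight B, and by B. H. Neumann's covering lemma every
   relation splits into relations between cosets of commensurable subgroups, where this index
   formula is enough. It holds for |Tor \<Omega>| / |Tor (\<Omega> / A)| * t ^ rank A, and trivially for subspaces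
   over an infinite field, which have no proper subspaces of finite index. *)

theory Submission
  imports Defs
begin

section \<open>Extending valuations from generators of a Boolean algebra\<close>


text \<open>The constants come from roots: |Tor (\<Omega> / A)| is the index of A in the group of
  all elements with a positive power in A. Subgroups B \<subseteq> A of finite index have the same
  roots, so the tower law makes the quotient scale exactly by [A : B], while the rank does not
  change. The numerator |Tor \<Omega>| normalises the value of a single point to 1. Polynomial
  coefficients are forced by the passage to products: once the indicators in one coordinate are
  replaced by their weights, these weights are part of the coefficients of the relation that remains
  in the other coordinates. In a single group the classes cannot be split off in any order. Cosets
  of a small subgroup may well be covered by cosets of larger ones, but Neumann's lemma forbids the
  reverse, so a class is peeled off only when no subgroup of another class virtually contains
  it.\<close>

lemma generated_boolean_algebra_subset:
  assumes "S \<in> generated_boolean_algebra X \<G>" and "\<Union>\<G> \<subseteq> X"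
  shows "S \<subseteq> X"
  using assms by induction auto

lemma generated_boolean_algebra_Int:
  assumes "S \<in> generated_boolean_algebra X \<G>" "T \<in> generated_boolean_algebra X \<G>"
    and "\<Union>\<G> \<subseteq> X"
  shows "S \<inter> T \<in> generated_boolean_algebra X \<G>"
proof -
  have "S \<inter> T = X - ((X - S) \<union> (X - T))"
    using generated_boolean_algebra_subset[OF assms(1,3)] by blast
  then show ?thesis
    using assms by (metis generated_boolean_algebra.compl generated_boolean_algebra.union)
qed

lemma generated_boolean_algebra_Diff:
  assumes "S \<in> generated_boolean_algebra X \<G>" "T \<in> generated_boolean_algebra X \<G>"
    and "\<Union>\<G> \<subseteq> X"
  shows "T - S \<in> generated_boolean_algebra X \<G>"
proof -
  have "T - S = T \<inter> (X - S)"
    using generated_boolean_algebra_subset[OF assms(2,3)] by blast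
  then show ?thesis
    using assms by (metis generated_boolean_algebra.compl generated_boolean_algebra_Int)
qed

text \<open>A finitary analogue of Dynkin's \<open>\<pi>\<close>-\<open>\<lambda>\<close> induction.\<close>

lemma generated_boolean_algebra_pi_induct [consumes 4, case_names empty generator diff union]:
  assumes S: "S \<in> generated_boolean_algebra X \<G>" and sub: "\<Union>\<G> \<subseteq> X" and top: "X \<in> \<G>"
    and inter: "\<forall>S\<in>\<G>. \<forall>T\<in>\<G>. S \<inter> T \<in> insert {} \<G>"
    and P0: "P {}"
    and Pgen: "\<And>S. S \<in> \<G> \<Longrightarrow> P S"
    and Pdiff: "\<And>S T. \<lbrakk>S \<in> generated_boolean_algebra X \<G>; T \<in> generated_boolean_algebra X \<G>;
                 S \<subseteq> T; P S; P T\<rbrakk> \<Longrightarrow> P (T - S)"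
    and Pun: "\<And>S T. \<lbrakk>S \<in> generated_boolean_algebra X \<G>; T \<in> generated_boolean_algebra X \<G>;
                 P S; P T; P (S \<inter> T)\<rbrakk> \<Longrightarrow> P (S \<union> T)"
  shows "P S"
proof -
  let ?B = "generated_boolean_algebra X \<G>"
  note B = generated_boolean_algebra.intros[where X = X and \<G> = \<G>]
  note BI = generated_boolean_algebra_Int[OF _ _ sub]
  \<comment> \<open>A bare \<open>P S\<close> would not pass through the induction, since a union
    also needs \<open>P\<close> of the intersection; \<open>D\<close> collects the sets on which
    \<open>P\<close> survives intersection with any generator.\<close>
  define D where "D = {S \<in> ?B. \<forall>L\<in>insert {} \<G>. P (S \<inter> L)}"
  have D_gen: "L \<in> D" if "L \<in> insert {} \<G>" for L
    unfolding D_def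
  proof safe
    show "L \<in> ?B" using that B(1,2) by blast
    show "P (L \<inter> {})" using P0 by simp
    show "P (L \<inter> M)" if "M \<in> \<G>" for M
      using \<open>L \<in> insert {} \<G>\<close> inter that P0 Pgen by (metis Int_empty_left insertE)
  qed
  \<comment> \<open>Ranging over all of \<open>D\<close> lets the union case chain two induction
    hypotheses: \<open>S' \<inter> T\<close> is in \<open>D\<close>, hence so is
    \<open>S \<inter> (S' \<inter> T)\<close>, the third set that \<open>Pun\<close> asks
    for.\<close>
  have "\<forall>T\<in>D. S \<inter> T \<in> D"
    using S
  proof induction
    case (generator S)
    show ?case
    proof
      fix T assume T: "T \<in> D"
      have "P (S \<inter> T \<inter> L)" if "L \<in> insert {} \<G>" for L
      proof -
        have "S \<inter> L \<in> insert {} \<G>" using inter generator that by blast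
        then have "P (T \<inter> (S \<inter> L))" using T unfolding D_def by blast
        then show ?thesis by (simp add: Int_ac)
      qed
      moreover have "S \<inter> T \<in> ?B" using T generator B(1) BI unfolding D_def by simp
      ultimately show "S \<inter> T \<in> D" unfolding D_def by blast
    qed
  next
    case empty
    then show ?case using D_gen by simp
  next
    case (compl S)
    show ?case
    proof
      fix T assume T: "T \<in> D"
      then have ST: "S \<inter> T \<in> D" using compl by blast
      have TB: "T \<in> ?B" using T D_def by blast
      have "P ((X - S) \<inter> T \<inter> L)" if L: "L \<in> insert {} \<G>" for L
      proof -
        have LB: "L \<in> ?B" using L B(1,2) by blast
        have "P (T \<inter> L - S \<inter> T \<inter> L)"
          using T ST L unfolding D_def by (intro Pdiff BI TB LB compl) auto
        moreover have "(X - S) \<inter> T \<inter> L = T \<inter> L - S \<inter> T \<inter> L"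
          using generated_boolean_algebra_subset[OF TB sub] by blast
        ultimately show ?thesis by simp
      qed
      moreover have "(X - S) \<inter> T \<in> ?B" using TB compl B(3) BI by simp
      ultimately show "(X - S) \<inter> T \<in> D" unfolding D_def by blast
    qed
  next
    case (union S S')
    show ?case
    proof
      fix T assume T: "T \<in> D"
      then have *: "S \<inter> T \<in> D" "S' \<inter> T \<in> D" "S \<inter> (S' \<inter> T) \<in> D" using union by blast+
      have TB: "T \<in> ?B" using T D_def by blast
      have "P ((S \<union> S') \<inter> T \<inter> L)" if L: "L \<in> insert {} \<G>" for L
      proof -
        have LB: "L \<in> ?B" using L B(1,2) by blast
        have "S \<inter> (S' \<inter> T) \<inter> L = S \<inter> T \<inter> L \<inter> (S' \<inter> T \<inter> L)" by blast
        then have "P ((S \<inter> T \<inter> L) \<union> (S' \<inter> T \<inter> L))"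
          using * L unfolding D_def by (intro Pun BI TB LB union) auto
        then show ?thesis by (simp add: Int_Un_distrib2)
      qed
      moreover have "(S \<union> S') \<inter> T \<in> ?B" using TB union B(4) BI by simp
      ultimately show "(S \<union> S') \<inter> T \<in> D" unfolding D_def by blast
    qed
  qed
  then have "S \<inter> X \<in> D" using top D_gen by blast
  then have "P (S \<inter> X \<inter> X)" using top unfolding D_def by blast
  then show ?thesis
    using generated_boolean_algebra_subset[OF S sub] by (simp add: Int_absorb2)
qed

lemma valuation_on_Diff:
  fixes f :: "'a set \<Rightarrow> 'r::ab_group_add"
  assumes "valuation_on (generated_boolean_algebra X \<G>) f" and sub: "\<Union>\<G> \<subseteq> X"
    and "S \<in> generated_boolean_algebra X \<G>" "T \<in> generated_boolean_algebra X \<G>" "S \<subseteq> T"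
  shows "f (T - S) = f T - f S"
proof -
  have "f ((T - S) \<union> S) + f ((T - S) \<inter> S) = f (T - S) + f S"
    using assms generated_boolean_algebra_Diff[OF assms(3,4) sub] unfolding valuation_on_def by blast
  moreover have "(T - S) \<union> S = T" "(T - S) \<inter> S = {}" using assms by auto
  ultimately show ?thesis using assms(1) unfolding valuation_on_def by simp
qed

lemma valuation_on_Un:
  fixes f :: "'a set \<Rightarrow> 'r::ab_group_add"
  assumes "valuation_on \<B> f" "S \<in> \<B>" "T \<in> \<B>"
  shows "f (S \<union> T) = f S + f T - f (S \<inter> T)"
  using assms unfolding valuation_on_def by (metis add_diff_cancel_right')

text \<open>The source of uniqueness: values on differences and unions are determined by values
  already known, so agreement on a family closed under intersection, up to the empty set, spreads to
  the whole algebra.\<close>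

lemma valuation_on_eqI:
  fixes f g :: "'a set \<Rightarrow> 'r::ab_group_add"
  assumes "valuation_on (generated_boolean_algebra X \<G>) f"
    and "valuation_on (generated_boolean_algebra X \<G>) g"
    and "\<Union>\<G> \<subseteq> X" "X \<in> \<G>" "\<forall>S\<in>\<G>. \<forall>T\<in>\<G>. S \<inter> T \<in> insert {} \<G>"
    and "\<And>S. S \<in> \<G> \<Longrightarrow> f S = g S"
    and "S \<in> generated_boolean_algebra X \<G>"
  shows "f S = g S"
  using assms(7,3,4,5)
proof (induction rule: generated_boolean_algebra_pi_induct)
  case empty
  then show ?case using assms unfolding valuation_on_def by simp
next
  case (diff S T)
  then show ?case using assms by (simp add: valuation_on_Diff)
next
  case (union S T)
  then show ?case using assms by (simp add: valuation_on_Un)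
qed (use assms in auto)

text \<open>Groemer's extension criterion. Generators are presented by codes \<open>c \<in> I\<close>, so that
  \<open>\<nu>\<close> may be given on the data describing a generator; the criterion applied to
  \<open>st c = st c'\<close> shows that the choice of the code does not matter.\<close>

lemma valuation_extension:
  fixes \<nu> :: "'c \<Rightarrow> 'r::comm_ring_1" and st :: "'c \<Rightarrow> 'a set"
  assumes sub: "\<Union>(st ` I) \<subseteq> X" and top: "X \<in> st ` I"
    and inter: "\<forall>S\<in>st ` I. \<forall>T\<in>st ` I. S \<inter> T \<in> insert {} (st ` I)"
    and rel: "\<And>xs. \<lbrakk>snd ` set xs \<subseteq> I; \<And>x. x \<in> X \<Longrightarrow> (\<Sum>(r, c)\<leftarrow>xs. r * of_bool (x \<in> st c)) = 0\<rbrakk>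
                \<Longrightarrow> (\<Sum>(r, c)\<leftarrow>xs. r * \<nu> c) = 0"
  shows "\<exists>f. valuation_on (generated_boolean_algebra X (st ` I)) f \<and> (\<forall>c\<in>I. f (st c) = \<nu> c)"
proof -
  let ?B = "generated_boolean_algebra X (st ` I)"
  define ev where "ev = (\<lambda>xs x. \<Sum>(r, c)\<leftarrow>xs. (r::'r) * of_bool (x \<in> st c))"
  define tot where "tot = (\<lambda>xs. \<Sum>(r, c)\<leftarrow>xs. (r::'r) * \<nu> c)"
  define neg where "neg = map (\<lambda>(r::'r, c::'c). (- r, c))"
  \<comment> \<open>\<open>rep xs S\<close> means that the formal combination \<open>xs\<close> of
    codes represents the indicator function of \<open>S\<close> on \<open>X\<close>.\<close>
  define rep where
    "rep = (\<lambda>xs S. snd ` set xs \<subseteq> I \<and> (\<forall>x\<in>X. ev xs x = (of_bool (x \<in> S) :: 'r)))"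
  have neg: "ev (neg xs) x = - ev xs x" "tot (neg xs) = - tot xs" "snd ` set (neg xs) = snd ` set xs"
    for xs x
    unfolding ev_def tot_def neg_def by (induction xs) auto
  have app: "ev (xs @ ys) x = ev xs x + ev ys x" "tot (xs @ ys) = tot xs + tot ys" for xs ys x
    unfolding ev_def tot_def by auto
  have rel': "tot xs = 0" if "snd ` set xs \<subseteq> I" "\<And>x. x \<in> X \<Longrightarrow> ev xs x = 0" for xs
    using rel that unfolding ev_def tot_def by blast
  have ex: "\<exists>xs. rep xs S" if "S \<in> ?B" for S
    using that sub top inter
  proof (induction rule: generated_boolean_algebra_pi_induct)
    case empty
    have "rep [] {}" unfolding rep_def ev_def by simp
    then show ?case by blast
  next
    case (generator S)
    then obtain c where c: "c \<in> I" "S = st c" by blast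
    then have "rep [(1, c)] S" unfolding rep_def ev_def by simp
    then show ?case by blast
  next
    case (diff S T)
    then obtain xs ys where "rep xs S" "rep ys T" by blast
    then have "rep (ys @ neg xs) (T - S)"
      using diff.hyps unfolding rep_def by (auto simp: app neg image_Un)
    then show ?case by blast
  next
    case (union S T)
    then obtain xs ys zs where "rep xs S" "rep ys T" "rep zs (S \<inter> T)" by blast
    then have "rep (xs @ ys @ neg zs) (S \<union> T)"
      unfolding rep_def by (auto simp: app neg image_Un)
    then show ?case by blast
  qed
  \<comment> \<open>The arbitrary choice is harmless: two representations of one set differ by a
    relation, on which \<open>rel\<close> makes the total vanish.\<close>
  define f where "f = (\<lambda>S. tot (SOME xs. rep xs S))"
  have f: "f S = tot xs" if "rep xs S" for xs S
  proof -
    let ?ys = "SOME xs. rep xs S"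
    have "rep ?ys S" using that by (rule someI)
    then have "tot (?ys @ neg xs) = 0"
      using that unfolding rep_def by (intro rel') (auto simp: app neg image_Un)
    then show ?thesis unfolding f_def by (simp add: app neg)
  qed
  have "f {} = 0"
    using f[of "[]" "{}"] unfolding rep_def ev_def tot_def by simp
  moreover have "f (S \<union> T) + f (S \<inter> T) = f S + f T" if ST: "S \<in> ?B" "T \<in> ?B" for S T
  proof -
    obtain xs ys us vs where r: "rep xs S" "rep ys T" "rep us (S \<union> T)" "rep vs (S \<inter> T)"
      using ex[OF ST(1)] ex[OF ST(2)] ex[OF generated_boolean_algebra.union[OF ST]]
        ex[OF generated_boolean_algebra_Int[OF ST sub]] by blast
    \<comment> \<open>The relation is the indicator identity 1_(S \<union> T) + 1_(S \<inter> T) =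
      1_S + 1_T.\<close>
    then have "tot (us @ vs @ neg xs @ neg ys) = 0"
      unfolding rep_def by (intro rel') (auto simp: app neg image_Un)
    then show ?thesis using r f by (simp add: app neg algebra_simps)
  qed
  moreover have "f (st c) = \<nu> c" if "c \<in> I" for c
    using f[of "[(1, c)]" "st c"] that unfolding rep_def ev_def tot_def by simp
  ultimately show ?thesis unfolding valuation_on_def by blast
qed

text \<open>Well-definedness of a tensor product of functionals. Freezing all coordinates except
  \<open>i\<close> leaves a relation in coordinate \<open>i\<close> alone, so its indicators may be
  replaced by the values \<open>m i j\<close>. These join the coefficients \<open>r j\<close>, and a
  relation of the same kind in fewer coordinates is left. Hence the hypothesis on a single
  coordinate has to admit arbitrary ring elements \<open>s j\<close>.\<close>

lemma tensor_relation:
  fixes r :: "'j \<Rightarrow> 'r::comm_ring_1" and m :: "'i \<Rightarrow> 'j \<Rightarrow> 'r"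
  assumes "finite I"
    and "\<And>i s. \<lbrakk>i \<in> I; \<And>z. z \<in> U i \<Longrightarrow> (\<Sum>j\<in>J. s j * of_bool (z \<in> C i j)) = 0\<rbrakk>
           \<Longrightarrow> (\<Sum>j\<in>J. s j * m i j) = 0"
    and "\<And>y. (\<And>i. i \<in> I \<Longrightarrow> y i \<in> U i) \<Longrightarrow>
           (\<Sum>j\<in>J. r j * (\<Prod>i\<in>I. of_bool (y i \<in> C i j))) = 0"
  shows "(\<Sum>j\<in>J. r j * (\<Prod>i\<in>I. m i j)) = 0"
  using assms
proof (induction I arbitrary: r rule: finite_induct)
  case empty
  then show ?case by simp
next
  case (insert i I)
  have "(\<Sum>j\<in>J. (r j * m i j) * (\<Prod>i\<in>I. m i j)) = 0"
  proof (rule insert.IH)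
    show "(\<Sum>j\<in>J. s j * m k j) = 0"
      if "k \<in> I" "\<And>z. z \<in> U k \<Longrightarrow> (\<Sum>j\<in>J. s j * of_bool (z \<in> C k j)) = 0" for k s
      using that(1) by (intro insert.prems(1)[OF _ that(2)]) simp_all
    fix y assume y: "\<And>i. i \<in> I \<Longrightarrow> y i \<in> U i"
    have "(\<Sum>j\<in>J. (r j * (\<Prod>i\<in>I. of_bool (y i \<in> C i j))) * m i j) = 0"
    proof (rule insert.prems(1))
      fix z assume z: "z \<in> U i"
      \<comment> \<open>Only coordinate \<open>i\<close> moves to \<open>z\<close>; the other
        factors are constant coefficients of a relation in \<open>z\<close>.\<close>
      have "(\<Prod>k\<in>I. of_bool ((y(i := z)) k \<in> C k j) :: 'r) = (\<Prod>k\<in>I. of_bool (y k \<in> C k j))"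
        for j using insert.hyps by (intro prod.cong) auto
      moreover have "(\<Sum>j\<in>J. r j * (\<Prod>k\<in>insert i I. of_bool ((y(i := z)) k \<in> C k j))) = 0"
        using y z by (intro insert.prems(2)) auto
      ultimately show "(\<Sum>j\<in>J. (r j * (\<Prod>k\<in>I. of_bool (y k \<in> C k j))) * of_bool (z \<in> C i j)) = 0"
        using insert.hyps by (simp add: mult_ac)
    qed simp
    then show "(\<Sum>j\<in>J. (r j * m i j) * (\<Prod>i\<in>I. of_bool (y i \<in> C i j))) = 0"
      by (simp add: mult_ac)
  qed
  then show ?case using insert.hyps by (simp add: mult.assoc)
qed

section \<open>Virtual containment of subgroups and relations between cosets\<close>


text \<open>For subgroups this says that A \<inter> B has finite index in A. Counting the cosets of
  \<open>B\<close> met by \<open>A\<close> requires no inclusion between the two; holding in both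
  directions it is commensurability.\<close>

definition virtually_contained :: "('a, 'b) monoid_scheme \<Rightarrow> 'a set \<Rightarrow> 'a set \<Rightarrow> bool" where
  "virtually_contained G A B \<longleftrightarrow> finite ((\<lambda>x. B #>\<^bsub>G\<^esub> x) ` A)"

context group
begin

lemma mem_rcoset_iff:
  assumes "subgroup H G" "x \<in> carrier G"
  shows "y \<in> H #> x \<longleftrightarrow> y \<in> carrier G \<and> y \<otimes> inv x \<in> H"
proof (cases "y \<in> carrier G")
  case True
  then show ?thesis using subgroup.rcos_module[OF assms(1) group_axioms assms(2)] by simp
next
  case False
  then show ?thesis using assms r_coset_subset_G subgroup.subset by blast
qed

lemma rcoset_eq_iff_mem:
  assumes "subgroup H G" "x \<in> carrier G" "y \<in> carrier G"
  shows "H #> y = H #> x \<longleftrightarrow> y \<in> H #> x"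
  using assms repr_independence rcos_self by metis

lemma rcoset_Int:
  assumes "subgroup A G" "subgroup B G" "x \<in> carrier G"
  shows "(A \<inter> B) #> x = (A #> x) \<inter> (B #> x)"
  using assms by (auto simp: mem_rcoset_iff subgroups_Inter_pair)

lemma rcosets_Int:
  assumes "subgroup A G" "subgroup B G" "x \<in> carrier G" "y \<in> carrier G"
    and "z \<in> (A #> x) \<inter> (B #> y)"
  shows "(A #> x) \<inter> (B #> y) = (A \<inter> B) #> z"
proof -
  have "z \<in> carrier G" using assms by (simp add: mem_rcoset_iff)
  moreover have "A #> x = A #> z" "B #> y = B #> z"
    using assms repr_independence by blast+
  ultimately show ?thesis using assms rcoset_Int by simp
qed

text \<open>If A \<subseteq> B X and B \<subseteq> C Y with finite sets X and Y of representatives,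
  then A \<subseteq> C Y X.\<close>

lemma virtually_contained_trans:
  assumes "virtually_contained G A B" "virtually_contained G B C"
    and A: "subgroup A G" and B: "subgroup B G" and C: "subgroup C G"
  shows "virtually_contained G A C"
proof -
  obtain X where X: "finite X" "X \<subseteq> A" "(\<lambda>x. B #> x) ` A = (\<lambda>x. B #> x) ` X"
    using finite_subset_image[OF assms(1)[unfolded virtually_contained_def] subset_refl] by blast
  obtain Y where Y: "finite Y" "Y \<subseteq> B" "(\<lambda>x. C #> x) ` B = (\<lambda>x. C #> x) ` Y"
    using finite_subset_image[OF assms(2)[unfolded virtually_contained_def] subset_refl] by blast
  have "(\<lambda>x. C #> x) ` A \<subseteq> (\<lambda>(y, x). C #> (y \<otimes> x)) ` (Y \<times> X)"
  proof safe
    fix a assume a: "a \<in> A"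
    then obtain x where x: "x \<in> X" "B #> a = B #> x" using X by blast
    have car: "a \<in> carrier G" "x \<in> carrier G"
      using a x(1) X(2) subgroup.subset[OF A] by auto
    then have "a \<otimes> inv x \<in> B"
      using x(2) rcoset_eq_iff_mem[OF B car(2,1)] mem_rcoset_iff[OF B car(2)] by simp
    then obtain y where y: "y \<in> Y" "C #> (a \<otimes> inv x) = C #> y" using Y by blast
    have "y \<in> carrier G" using y(1) Y(2) subgroup.subset[OF B] by auto
    then have "C #> (y \<otimes> x) = (C #> (a \<otimes> inv x)) #> x"
      using y car C by (simp add: coset_mult_assoc subgroup.subset)
    also have "\<dots> = C #> a"
      using car C by (simp add: coset_mult_assoc subgroup.subset m_assoc)
    finally show "C #> a \<in> (\<lambda>(y, x). C #> (y \<otimes> x)) ` (Y \<times> X)"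
      using x y by force
  qed
  then show ?thesis
    unfolding virtually_contained_def using X Y by (meson finite_SigmaI finite_imageI finite_subset)
qed

lemma virtually_contained_subset:
  assumes "A \<subseteq> B" "subgroup B G"
  shows "virtually_contained G A B"
proof -
  have "(\<lambda>x. B #> x) ` A \<subseteq> {B}"
    using assms coset_join2[OF subgroup.mem_carrier[OF assms(2)] assms(2)] by auto
  then show ?thesis unfolding virtually_contained_def using finite_subset by blast
qed

text \<open>A coset of \<open>B \<inter> C\<close> is the intersection of the cosets of
  \<open>B\<close> and of \<open>C\<close> through the same point, so finitely many pairs bound the
  number of such cosets.\<close>

lemma virtually_contained_Int:
  assumes "virtually_contained G A B" "virtually_contained G A C"
    and A: "subgroup A G" and B: "subgroup B G" and C: "subgroup C G"
  shows "virtually_contained G A (B \<inter> C)"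
proof -
  have "(\<lambda>x. (B \<inter> C) #> x) ` A \<subseteq>
      (\<lambda>(S, T). S \<inter> T) ` (((\<lambda>x. B #> x) ` A) \<times> ((\<lambda>x. C #> x) ` A))"
    using rcoset_Int[OF B C] subgroup.mem_carrier[OF A] by auto
  then show ?thesis
    using assms(1,2) unfolding virtually_contained_def by (meson finite_SigmaI finite_imageI finite_subset)
qed

text \<open>B. H. Neumann's covering lemma, by induction on the number of subgroups: if \<open>B\<close> is not
  virtually contained in \<open>H\<close>, some coset \<open>(H \<inter> B) b\<close> misses all chosen cosets of \<open>H\<close>; it is then
  covered by cosets of the other subgroups, and so are all its translates.\<close>

lemma Neumann_covering:
  assumes "finite \<H>" and "\<And>H. H \<in> \<H> \<Longrightarrow> subgroup H G" and B: "subgroup B G"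
    and "finite Y" "Y \<subseteq> carrier G" "B \<subseteq> (\<Union>H\<in>\<H>. \<Union>y\<in>Y. H #> y)"
  shows "\<exists>H\<in>\<H>. virtually_contained G B H"
  using assms
proof (induction \<H> arbitrary: Y rule: finite_induct)
  case empty
  then show ?case using subgroup.one_closed[OF B] by auto
next
  case (insert H \<H>)
  show ?case
  proof (cases "virtually_contained G B H")
    case True
    then show ?thesis by blast
  next
    case False
    have H: "subgroup H G" using insert.prems by blast
    have Bc: "B \<subseteq> carrier G" using B subgroup.subset by blast
    \<comment> \<open>Finitely many representatives cannot exhaust the infinitely many cosets of
      \<open>H\<close> that meet \<open>B\<close>.\<close>
    have "\<not> (\<lambda>x. H #> x) ` B \<subseteq> (\<lambda>y. H #> y) ` Y"
      using False \<open>finite Y\<close> unfolding virtually_contained_def by (meson finite_imageI finite_subset)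
    then obtain b where b: "b \<in> B" "\<And>y. y \<in> Y \<Longrightarrow> H #> b \<noteq> H #> y" by blast
    have bc: "b \<in> carrier G" using b Bc by blast
    have cov: "(H \<inter> B) #> b \<subseteq> (\<Union>H\<in>\<H>. \<Union>y\<in>Y. H #> y)"
    proof
      fix x assume x: "x \<in> (H \<inter> B) #> b"
      then have xH: "x \<in> H #> b" and xB: "x \<in> B #> b"
        using rcoset_Int H B bc by blast+
      have "x \<in> B" using xB b B bc coset_join2 by blast
      then obtain H' y where H': "H' \<in> insert H \<H>" "y \<in> Y" "x \<in> H' #> y"
        using insert.prems(5) by blast
      have "H' \<noteq> H"
        using H' xH b(2)[OF H'(2)] repr_independence[OF _ _ H] bc insert.prems(4) by (metis subsetD)
      then show "x \<in> (\<Union>H\<in>\<H>. \<Union>y\<in>Y. H #> y)" using H' by blast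
    qed
    \<comment> \<open>\<open>z y\<close> is a point of \<open>B\<close> in \<open>H #> y\<close>.
      Right multiplication by \<open>inv (z y) \<otimes> b\<close> carries the part of
      \<open>B\<close> in \<open>H #> y\<close> into \<open>(H \<inter> B) #> b\<close>, which the
      other subgroups cover; translating their cosets back gives the new representatives in
      \<open>Y'\<close>.\<close>
    define z where "z y = (SOME z. z \<in> B \<inter> (H #> y))" for y
    define Y' where "Y' = Y \<union> (\<lambda>(y', y). y' \<otimes> (inv b \<otimes> z y)) ` (Y \<times> {y\<in>Y. B \<inter> (H #> y) \<noteq> {}})"
    have z: "z y \<in> B \<inter> (H #> y)" if "B \<inter> (H #> y) \<noteq> {}" for y
      using that unfolding z_def by (meson ex_in_conv someI_ex)
    have zc: "z y \<in> carrier G" if "B \<inter> (H #> y) \<noteq> {}" for y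
      using z[OF that] Bc by blast
    have "B \<subseteq> (\<Union>H\<in>\<H>. \<Union>y\<in>Y'. H #> y)"
    proof
      fix x assume x: "x \<in> B"
      then obtain H' y where H': "H' \<in> insert H \<H>" "y \<in> Y" "x \<in> H' #> y"
        using insert.prems(5) by blast
      show "x \<in> (\<Union>H\<in>\<H>. \<Union>y\<in>Y'. H #> y)"
      proof (cases "H' \<in> \<H>")
        case True
        then show ?thesis using H' unfolding Y'_def by blast
      next
        case False
        then have xH: "x \<in> H #> y" using H' by blast
        then have ne: "B \<inter> (H #> y) \<noteq> {}" using x by blast
        have c: "x \<in> carrier G" "z y \<in> carrier G" "y \<in> carrier G"
          using x Bc zc ne H' insert.prems by blast+
        have "H #> z y = H #> y"
          using z[OF ne] repr_independence[OF _ c(3) H] by blast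
        then have "x \<otimes> inv (z y) \<in> H" using xH mem_rcoset_iff[OF H c(2)] by blast
        moreover have "x \<otimes> inv (z y) \<in> B"
          using x z[OF ne] B by (simp add: subgroup_def)
        ultimately have "(x \<otimes> inv (z y)) \<otimes> b \<in> (H \<inter> B) #> b"
          using bc H B by (intro rcosI) (auto dest: subgroup.subset)
        then obtain K y' where K: "K \<in> \<H>" "y' \<in> Y" "(x \<otimes> inv (z y)) \<otimes> b \<in> K #> y'"
          using cov by blast
        have K': "subgroup K G" and y': "y' \<in> carrier G" using K insert.prems by blast+
        have "x \<in> K #> (y' \<otimes> (inv b \<otimes> z y))"
          using K(3) K' y' bc c by (simp add: mem_rcoset_iff inv_mult_group m_assoc)
        moreover have "y' \<otimes> (inv b \<otimes> z y) \<in> Y'"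
          using K H' ne unfolding Y'_def by force
        ultimately show ?thesis using K by blast
      qed
    qed
    moreover have "finite Y'" unfolding Y'_def using insert.prems by simp
    moreover have "Y' \<subseteq> carrier G" unfolding Y'_def using insert.prems(4) bc zc by (auto intro!: m_closed)
    ultimately have "\<exists>H\<in>\<H>. virtually_contained G B H"
      using insert.IH[of Y'] insert.prems by blast
    then show ?thesis by blast
  qed
qed

text \<open>Unconditional, because \<open>card\<close> of an infinite set is zero.\<close>

lemma card_rcosets_tower:
  assumes T: "subgroup T G" and A: "subgroup A G" and B: "subgroup B G" and "B \<subseteq> A" "A \<subseteq> T"
  shows "card ((\<lambda>x. B #> x) ` T) = card ((\<lambda>x. A #> x) ` T) * card ((\<lambda>x. B #> x) ` A)"
proof -
  define \<rho> where "\<rho> = inv_into T (\<lambda>x. A #> x)"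
  have \<rho>: "\<rho> D \<in> T" "A #> \<rho> D = D" if "D \<in> (\<lambda>x. A #> x) ` T" for D
    using inv_into_into[OF that] f_inv_into_f[OF that] unfolding \<rho>_def by blast+
  have Tc: "\<And>x. x \<in> T \<Longrightarrow> x \<in> carrier G" and Ac: "\<And>x. x \<in> A \<Longrightarrow> x \<in> carrier G"
    and Bc: "B \<subseteq> carrier G"
    using subgroup.mem_carrier[OF T] subgroup.mem_carrier[OF A] subgroup.subset[OF B] by auto
  have sub: "B #> (a \<otimes> x) \<subseteq> A #> x" if "a \<in> A" "x \<in> T" for a x
  proof
    fix y assume y: "y \<in> B #> (a \<otimes> x)"
    have c: "a \<in> carrier G" "x \<in> carrier G" using that Ac Tc by blast+
    have yc: "y \<in> carrier G" and "y \<otimes> inv (a \<otimes> x) \<in> A"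
      using y mem_rcoset_iff[OF B m_closed[OF c]] \<open>B \<subseteq> A\<close> by auto
    then have "y \<otimes> inv (a \<otimes> x) \<otimes> a \<in> A" using subgroup.m_closed[OF A] that(1) by blast
    moreover have "y \<otimes> inv (a \<otimes> x) \<otimes> a = y \<otimes> inv x"
      using yc c by (simp add: inv_mult_group m_assoc)
    ultimately show "y \<in> A #> x" using mem_rcoset_iff[OF A c(2)] yc by simp
  qed
  \<comment> \<open>A coset \<open>E\<close> of \<open>B\<close> inside \<open>A\<close>, moved by
    the representative of \<open>D\<close>, lies inside \<open>D\<close>: this recovers
    \<open>D\<close>, and undoing the translation recovers \<open>E\<close>.\<close>
  let ?f = "\<lambda>(D, E). E #> \<rho> D"
  have "bij_betw ?f ((\<lambda>x. A #> x) ` T \<times> (\<lambda>x. B #> x) ` A) ((\<lambda>x. B #> x) ` T)"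
  proof (rule bij_betw_imageI)
    show "inj_on ?f ((\<lambda>x. A #> x) ` T \<times> (\<lambda>x. B #> x) ` A)"
    proof (rule inj_onI, clarify)
      fix x a x' a'
      assume h: "x \<in> T" "a \<in> A" "x' \<in> T" "a' \<in> A"
        and eq: "(B #> a) #> \<rho> (A #> x) = (B #> a') #> \<rho> (A #> x')"
      let ?D = "A #> x" and ?D' = "A #> x'"
      have D: "?D \<in> (\<lambda>x. A #> x) ` T" "?D' \<in> (\<lambda>x. A #> x) ` T" using h by blast+
      have c: "\<rho> ?D \<in> carrier G" "\<rho> ?D' \<in> carrier G" "a \<in> carrier G" "a' \<in> carrier G"
        using \<rho>(1)[OF D(1)] \<rho>(1)[OF D(2)] Tc Ac h by auto
      have eq': "B #> (a \<otimes> \<rho> ?D) = B #> (a' \<otimes> \<rho> ?D')"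
        using eq c Bc by (simp add: coset_mult_assoc)
      have m: "a \<otimes> \<rho> ?D \<in> B #> (a \<otimes> \<rho> ?D)" using rcos_self[OF _ B] c by blast
      then have "a \<otimes> \<rho> ?D \<in> ?D" "a \<otimes> \<rho> ?D \<in> ?D'"
        using sub[OF h(2) \<rho>(1)[OF D(1)]] sub[OF h(4) \<rho>(1)[OF D(2)]] eq' \<rho>(2) D by auto
      then have DD: "?D = ?D'"
        using repr_independence[OF _ Tc[OF h(1)] A] repr_independence[OF _ Tc[OF h(3)] A] by blast
      have "((B #> a) #> \<rho> ?D) #> inv (\<rho> ?D) = ((B #> a') #> \<rho> ?D) #> inv (\<rho> ?D)"
        using eq DD by simp
      then have "B #> a = B #> a'"
        using c Bc by (simp add: coset_mult_assoc m_assoc)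
      with DD show "?D = ?D' \<and> B #> a = B #> a'" by blast
    qed
    show "?f ` ((\<lambda>x. A #> x) ` T \<times> (\<lambda>x. B #> x) ` A) = (\<lambda>x. B #> x) ` T"
    proof safe
      fix x a assume h: "x \<in> T" "a \<in> A"
      have r: "\<rho> (A #> x) \<in> T" using \<rho>(1)[OF imageI[OF h(1)]] .
      then have "(B #> a) #> \<rho> (A #> x) = B #> (a \<otimes> \<rho> (A #> x))"
        using coset_mult_assoc[OF Bc Ac[OF h(2)] Tc] by blast
      moreover have "a \<otimes> \<rho> (A #> x) \<in> T"
        using subgroup.m_closed[OF T subsetD[OF \<open>A \<subseteq> T\<close> h(2)] r] .
      ultimately show "(B #> a) #> \<rho> (A #> x) \<in> (\<lambda>x. B #> x) ` T" by simp
    next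
      fix x assume x: "x \<in> T"
      let ?r = "\<rho> (A #> x)"
      have r: "?r \<in> T" "A #> ?r = A #> x" using \<rho>[OF imageI[OF x]] .
      then have c: "?r \<in> carrier G" "x \<in> carrier G" using Tc x by auto
      have "x \<otimes> inv ?r \<in> A"
        using r c mem_rcoset_iff[OF A c(1)] rcos_self[OF c(2) A] by simp
      moreover have "(B #> (x \<otimes> inv ?r)) #> ?r = B #> x"
        using c Bc by (simp add: coset_mult_assoc m_assoc)
      ultimately show "B #> x \<in> ?f ` ((\<lambda>x. A #> x) ` T \<times> (\<lambda>x. B #> x) ` A)"
        using x by (intro image_eqI[of _ _ "(A #> x, B #> (x \<otimes> inv ?r))"]) auto
    qed
  qed
  then show ?thesis by (metis bij_betw_same_card card_cartesian_product)
qed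



section \<open>Linear relations between indicators of cosets\<close>

lemma rcoset_subset_rcoset:
  assumes "subgroup A G" "B \<subseteq> A" "x \<in> carrier G" "a \<in> A #> x"
  shows "B #> a \<subseteq> A #> x"
proof -
  have "A #> x = A #> a" using assms repr_independence by blast
  then show ?thesis using assms(2) unfolding r_coset_def by blast
qed

text \<open>Every coset \<open>A j #> x j\<close> is a disjoint union of [A j : B] cosets of
  \<open>B\<close>, so the relation lives on a finite set of these smaller cosets. The coefficients
  cancel at each of them, and giving each the weight \<open>\<mu> B\<close> yields the claim through
  the index formula.\<close>

lemma commensurable_coset_relation:
  fixes \<mu> :: "'a set \<Rightarrow> 'r::comm_ring_1"
  assumes B: "subgroup B G" and A: "\<And>j. j \<in> J \<Longrightarrow> subgroup (A j) G"
    and BA: "\<And>j. j \<in> J \<Longrightarrow> B \<subseteq> A j"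
    and fin: "\<And>j. j \<in> J \<Longrightarrow> virtually_contained G (A j) B"
    and \<mu>: "\<And>j. j \<in> J \<Longrightarrow> \<mu> (A j) = of_nat (card ((\<lambda>a. B #> a) ` A j)) * \<mu> B"
    and J: "finite J" and x: "\<And>j. j \<in> J \<Longrightarrow> x j \<in> carrier G"
    and rel: "\<And>z. z \<in> carrier G \<Longrightarrow> (\<Sum>j\<in>J. r j * of_bool (z \<in> A j #> x j)) = 0"
  shows "(\<Sum>j\<in>J. r j * \<mu> (A j)) = 0"
proof -
  have Bc: "B \<subseteq> carrier G" using subgroup.subset[OF B] .
  define Q where "Q j = (\<lambda>a. B #> a) ` (A j #> x j)" for j
  define \<D> where "\<D> = (\<Union>j\<in>J. Q j)"
  \<comment> \<open>One point per coset of \<open>B\<close> suffices: such a coset is either inside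
    \<open>A j #> x j\<close> or disjoint from it.\<close>
  define \<rho> where "\<rho> = inv_into (carrier G) (\<lambda>a. B #> a)"
  have Q: "Q j = (\<lambda>D. D #> x j) ` ((\<lambda>a. B #> a) ` A j)" if "j \<in> J" for j
  proof -
    have "Q j = (\<lambda>a. B #> (a \<otimes> x j)) ` A j"
      unfolding Q_def r_coset_def[of G "A j"] by auto
    also have "\<dots> = (\<lambda>a. (B #> a) #> x j) ` A j"
      using coset_mult_assoc[OF Bc subgroup.mem_carrier[OF A[OF that]] x[OF that]]
      by (intro image_cong) auto
    finally show ?thesis by (simp add: image_image)
  qed
  have inj: "inj_on (\<lambda>D. D #> x j) ((\<lambda>a. B #> a) ` A j)" if "j \<in> J" for j
  proof (rule inj_on_inverseI[where g = "\<lambda>D. D #> inv (x j)"])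
    fix D assume "D \<in> (\<lambda>a. B #> a) ` A j"
    then obtain a where a: "a \<in> A j" "D = B #> a" by blast
    then have "D \<subseteq> carrier G"
      using r_coset_subset_G[OF Bc subgroup.mem_carrier[OF A[OF that]]] by blast
    then show "D #> x j #> inv (x j) = D" using x[OF that] by (simp add: coset_mult_assoc)
  qed
  have "finite (Q j)" if "j \<in> J" for j
    using Q[OF that] fin[OF that] unfolding virtually_contained_def by simp
  then have \<D>: "finite \<D>" unfolding \<D>_def using J by blast
  have \<rho>: "\<rho> D \<in> carrier G" "B #> \<rho> D = D" if "D \<in> \<D>" for D
  proof -
    obtain j a where "j \<in> J" "a \<in> A j #> x j" "D = B #> a"
      using \<open>D \<in> \<D>\<close> unfolding \<D>_def Q_def by blast
    then have "D \<in> (\<lambda>a. B #> a) ` carrier G"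
      using mem_rcoset_iff[OF A x] by blast
    from inv_into_into[OF this] f_inv_into_f[OF this]
    show "\<rho> D \<in> carrier G" "B #> \<rho> D = D" unfolding \<rho>_def by simp_all
  qed
  have Q_iff: "D \<in> Q j \<longleftrightarrow> \<rho> D \<in> A j #> x j" if j: "j \<in> J" and D: "D \<in> \<D>" for j D
  proof
    assume "D \<in> Q j"
    then obtain a where "a \<in> A j #> x j" "D = B #> a" unfolding Q_def by blast
    then have "D \<subseteq> A j #> x j" using rcoset_subset_rcoset[OF A BA x] j by blast
    then show "\<rho> D \<in> A j #> x j" using \<rho>[OF D] rcos_self[OF _ B] by blast
  next
    assume "\<rho> D \<in> A j #> x j"
    then show "D \<in> Q j" using \<rho>(2)[OF D] unfolding Q_def by force
  qed
  have "\<mu> (A j) = (\<Sum>D\<in>\<D>. of_bool (\<rho> D \<in> A j #> x j)) * \<mu> B" if j: "j \<in> J" for j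
  proof -
    have "card ((\<lambda>a. B #> a) ` A j) = card (Q j)"
      using card_image[OF inj[OF j]] Q[OF j] by simp
    also have "Q j = {D \<in> \<D>. \<rho> D \<in> A j #> x j}"
      using Q_iff[OF j] j unfolding \<D>_def by blast
    finally show ?thesis
      using \<mu>[OF j] \<D> by (simp add: of_bool_def sum.If_cases Int_def)
  qed
  then have "(\<Sum>j\<in>J. r j * \<mu> (A j)) = (\<Sum>j\<in>J. \<Sum>D\<in>\<D>. r j * of_bool (\<rho> D \<in> A j #> x j)) * \<mu> B"
    by (simp add: sum_distrib_left sum_distrib_right mult.assoc)
  also have "\<dots> = (\<Sum>D\<in>\<D>. \<Sum>j\<in>J. r j * of_bool (\<rho> D \<in> A j #> x j)) * \<mu> B"
    by (subst sum.swap) simp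
  also have "\<dots> = 0" using rel \<rho>(1) by simp
  finally show ?thesis .
qed

lemma virtually_contained_INT:
  assumes "finite K" "K \<noteq> {}" "\<And>j. j \<in> K \<Longrightarrow> A j \<in> Sub"
    and Sub: "\<And>A. A \<in> Sub \<Longrightarrow> subgroup A G"
    and SubI: "\<And>A B. A \<in> Sub \<Longrightarrow> B \<in> Sub \<Longrightarrow> A \<inter> B \<in> Sub"
    and C: "subgroup C G" and "\<And>j. j \<in> K \<Longrightarrow> virtually_contained G C (A j)"
  shows "(\<Inter>j\<in>K. A j) \<in> Sub \<and> virtually_contained G C (\<Inter>j\<in>K. A j)"
  using assms(1-3,7)
proof (induction K rule: finite_ne_induct)
  case (singleton j)
  then show ?case by simp
next
  case (insert j K)
  then have IH: "(\<Inter>j\<in>K. A j) \<in> Sub" "virtually_contained G C (\<Inter>j\<in>K. A j)" by blast+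
  have j: "A j \<in> Sub" "virtually_contained G C (A j)" using insert.prems by blast+
  have "virtually_contained G C (A j \<inter> (\<Inter>j\<in>K. A j))"
    using virtually_contained_Int[OF j(2) IH(2) C Sub[OF j(1)] Sub[OF IH(1)]] .
  then show ?case using SubI[OF j(1) IH(1)] by simp
qed

text \<open>Among the commensurability classes of the subgroups involved choose one that is maximal for
  virtual containment. By Neumann's lemma the terms of this class already cancel among themselves,
  and they can be compared through cosets of the intersection of the class.\<close>

lemma coset_relation:
  fixes \<mu> :: "'a set \<Rightarrow> 'r::comm_ring_1"
  assumes Sub: "\<And>A. A \<in> Sub \<Longrightarrow> subgroup A G"
    and SubI: "\<And>A B. A \<in> Sub \<Longrightarrow> B \<in> Sub \<Longrightarrow> A \<inter> B \<in> Sub"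
    and \<mu>: "\<And>A B. \<lbrakk>A \<in> Sub; B \<in> Sub; B \<subseteq> A; virtually_contained G A B\<rbrakk>
              \<Longrightarrow> \<mu> A = of_nat (card ((\<lambda>a. B #> a) ` A)) * \<mu> B"
    and "finite J" and "\<And>j. j \<in> J \<Longrightarrow> A j \<in> Sub" and "\<And>j. j \<in> J \<Longrightarrow> x j \<in> carrier G"
    and "\<And>z. z \<in> carrier G \<Longrightarrow> (\<Sum>j\<in>J. r j * of_bool (z \<in> A j #> x j)) = 0"
  shows "(\<Sum>j\<in>J. r j * \<mu> (A j)) = 0"
  using assms(4-7)
proof (induction J rule: finite_psubset_induct)
  case (psubset J)
  let ?vc = "virtually_contained G"
  have A: "subgroup (A j) G" if "j \<in> J" for j using Sub[OF psubset.prems(1)[OF that]] .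
  show ?case
  proof (cases "J = {}")
    case True
    then show ?thesis by simp
  next
    case False
    \<comment> \<open>Virtual containment is only a preorder, so maximality is taken for its strict
      part.\<close>
    let ?R = "\<lambda>i j. ?vc (A i) (A j) \<and> \<not> ?vc (A j) (A i)"
    have "asymp_on J ?R" by (auto simp: asymp_on_def)
    moreover have "transp_on J ?R"
    proof (rule transp_onI)
      fix i j k assume i: "i \<in> J" "j \<in> J" "k \<in> J" and R: "?R i j" "?R j k"
      have "?vc (A i) (A k)"
        using virtually_contained_trans[of "A i" "A j" "A k"] i A R by blast
      moreover have "\<not> ?vc (A k) (A i)"
        using virtually_contained_trans[of "A k" "A i" "A j"] i A R by blast
      ultimately show "?R i k" by blast
    qed
    ultimately have "\<exists>m\<in>J. \<forall>j\<in>J. j \<noteq> m \<longrightarrow> \<not> ?R m j"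
      using Finite_Set.bex_max_element[OF psubset.hyps(1) _ _ False] by blast
    then obtain m where m: "m \<in> J" and "\<forall>j\<in>J. j \<noteq> m \<longrightarrow> \<not> ?R m j" by blast
    then have max: "?vc (A j) (A m)" if "j \<in> J" "?vc (A m) (A j)" for j
      using that by (cases "j = m") auto
    \<comment> \<open>By the choice of \<open>m\<close>, containment in this direction already
      implies the reverse one, so \<open>K\<close> indexes the full commensurability class of
      \<open>A m\<close> in the relation.\<close>
    define K where "K = {j \<in> J. ?vc (A m) (A j)}"
    have K: "K \<subseteq> J" "finite K" "m \<in> K"
      using m virtually_contained_subset[OF subset_refl A[OF m]] finite_subset[OF _ psubset.hyps(1)]
      unfolding K_def by auto
    define B where "B = (\<Inter>j\<in>K. A j)"
    have "B \<in> Sub \<and> ?vc (A m) B"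
      unfolding B_def
    proof (rule virtually_contained_INT)
      show "K \<noteq> {}" using K by blast
      show "A j \<in> Sub" if "j \<in> K" for j using that K psubset.prems by blast
      show "?vc (A m) (A j)" if "j \<in> K" for j using that unfolding K_def by blast
    qed (use K Sub SubI A[OF m] in auto)
    then have BSub: "B \<in> Sub" and mB: "?vc (A m) B" by blast+
    have B: "subgroup B G" using Sub[OF BSub] .
    have KB: "B \<subseteq> A j" "?vc (A j) B" if "j \<in> K" for j
    proof -
      have j: "j \<in> J" "?vc (A m) (A j)" using that unfolding K_def by auto
      show "B \<subseteq> A j" using that unfolding B_def by blast
      show "?vc (A j) B"
        using virtually_contained_trans[OF max[OF j] mB A[OF j(1)] A[OF m] B] .
    qed
    have relK: "(\<Sum>j\<in>K. r j * of_bool (z \<in> A j #> x j)) = 0" if z: "z \<in> carrier G" for z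
    proof (rule ccontr)
      assume nz: "(\<Sum>j\<in>K. r j * of_bool (z \<in> A j #> x j)) \<noteq> 0"
      \<comment> \<open>Left multiplication by elements of \<open>B\<close> preserves the cosets
        \<open>A j #> x j\<close> with \<open>j \<in> K\<close>, so the nonzero partial sum is
        constant along B z. To compensate for it, terms outside \<open>K\<close> must cover B z.
        Neumann's lemma then makes some \<open>A j\<close> with \<open>j \<notin> K\<close>
        virtually contain \<open>B\<close>, hence \<open>A m\<close>, against the definition of
        \<open>K\<close>.\<close>
      have cov: "B \<subseteq> (\<Union>H\<in>A ` (J - K). \<Union>y\<in>(\<lambda>j. x j \<otimes> inv z) ` J. H #> y)"
      proof
        fix b assume b: "b \<in> B"
        have bc: "b \<in> carrier G" using b subgroup.mem_carrier[OF B] by blast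
        have mem: "b \<otimes> z \<in> A j #> x j \<longleftrightarrow> z \<in> A j #> x j" if "j \<in> K" for j
        proof -
          have j: "j \<in> J" using that K by blast
          have bA: "b \<in> A j" using KB[OF that] b by blast
          have "A j #> (b \<otimes> z) = (A j #> b) #> z"
            using coset_mult_assoc[OF subgroup.subset[OF A[OF j]] bc z] by simp
          also have "A j #> b = A j" using coset_join2[OF bc A[OF j] bA] .
          finally show ?thesis
            using rcoset_eq_iff_mem[OF A[OF j] psubset.prems(2)[OF j]] z bc by (metis m_closed)
        qed
        have "(\<Sum>j\<in>J. r j * of_bool (b \<otimes> z \<in> A j #> x j)) = 0"
          using psubset.prems(3) bc z by simp
        moreover have "(\<Sum>j\<in>K. r j * of_bool (b \<otimes> z \<in> A j #> x j)) \<noteq> 0"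
          using nz mem by simp
        ultimately have "(\<Sum>j\<in>J - K. r j * of_bool (b \<otimes> z \<in> A j #> x j)) \<noteq> 0"
          using sum.subset_diff[OF K(1) psubset.hyps(1)] by (metis add_cancel_left_left)
        then obtain j where "j \<in> J - K" "r j * of_bool (b \<otimes> z \<in> A j #> x j) \<noteq> 0"
          by (rule sum.not_neutral_contains_not_neutral)
        then have j: "j \<in> J - K" "b \<otimes> z \<in> A j #> x j" by (auto simp: of_bool_def split: if_splits)
        have xj: "x j \<in> carrier G" and Aj: "subgroup (A j) G" using j psubset.prems A by blast+
        have "b \<in> A j #> (x j \<otimes> inv z)"
          using j(2) xj z bc by (simp add: mem_rcoset_iff[OF Aj] inv_mult_group m_assoc)
        then show "b \<in> (\<Union>H\<in>A ` (J - K). \<Union>y\<in>(\<lambda>j. x j \<otimes> inv z) ` J. H #> y)"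
          using j(1) by blast
      qed
      have "\<exists>H\<in>A ` (J - K). ?vc B H"
        by (rule Neumann_covering[OF _ _ B _ _ cov]) (use psubset.hyps(1) psubset.prems(2) z A in auto)
      then obtain j where j: "j \<in> J" "j \<notin> K" "?vc B (A j)" by blast
      then have "?vc (A m) (A j)"
        using virtually_contained_trans[OF mB _ A[OF m] B A] by blast
      then show False using j unfolding K_def by blast
    qed
    have "(\<Sum>j\<in>K. r j * \<mu> (A j)) = 0"
    proof (rule commensurable_coset_relation[OF B _ _ _ _ _ _ relK])
      show "\<mu> (A j) = of_nat (card ((\<lambda>a. B #> a) ` A j)) * \<mu> B" if "j \<in> K" for j
        using \<mu>[OF _ BSub KB[OF that]] psubset.prems(1) that K by blast
    qed (use K A KB relK psubset.prems in auto)
    moreover have "(\<Sum>j\<in>J - K. r j * \<mu> (A j)) = 0"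
    proof (rule psubset.IH)
      show "J - K \<subset> J" using K by blast
      fix z assume z: "z \<in> carrier G"
      show "(\<Sum>j\<in>J - K. r j * of_bool (z \<in> A j #> x j)) = 0"
        using sum.subset_diff[OF K(1) psubset.hyps(1), of "\<lambda>j. r j * of_bool (z \<in> A j #> x j)"]
          relK[OF z] psubset.prems(3)[OF z] by simp
    qed (use psubset.prems in auto)
    ultimately show ?thesis
      using sum.subset_diff[OF K(1) psubset.hyps(1), of "\<lambda>j. r j * \<mu> (A j)"] by simp
  qed
qed

end

section \<open>Translations and products\<close>


lemma rat_polys_add: "p \<in> rat_polys n \<Longrightarrow> q \<in> rat_polys n \<Longrightarrow> p + q \<in> rat_polys n"
  unfolding rat_polys_def using Poly_Mapping.keys_add[of p q] by blast

lemma rat_polys_diff: "p \<in> rat_polys n \<Longrightarrow> q \<in> rat_polys n \<Longrightarrow> p - q \<in> rat_polys n"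
  unfolding rat_polys_def using keys_diff[of p q] by blast

lemma rat_polys_mult:
  assumes "p \<in> rat_polys n" "q \<in> rat_polys n"
  shows "p * q \<in> rat_polys n"
proof -
  have "Poly_Mapping.keys m \<subseteq> {1..n}" if "m \<in> Poly_Mapping.keys (p * q)" for m
  proof -
    obtain a b where "m = a + b" "a \<in> Poly_Mapping.keys p" "b \<in> Poly_Mapping.keys q"
      using \<open>m \<in> Poly_Mapping.keys (p * q)\<close> keys_mult[of p q] by blast
    then show ?thesis
      using assms Poly_Mapping.keys_add[of a b] unfolding rat_polys_def by blast
  qed
  then show ?thesis unfolding rat_polys_def by blast
qed

lemma rat_polys_Const: "Const c \<in> rat_polys n"
  unfolding rat_polys_def Const_def by simp

lemma rat_polys_one: "1 \<in> rat_polys n"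
  using rat_polys_Const[of 1 n] unfolding Const_def by simp

lemma rat_polys_Var: "i \<in> {1..n} \<Longrightarrow> Var i \<in> rat_polys n"
  unfolding rat_polys_def Var_def by simp

lemma rat_polys_power: "p \<in> rat_polys n \<Longrightarrow> p ^ k \<in> rat_polys n"
  by (induction k) (simp_all add: rat_polys_one rat_polys_mult)

lemma rat_polys_prod: "(\<And>i. i \<in> I \<Longrightarrow> p i \<in> rat_polys n) \<Longrightarrow> (\<Prod>i\<in>I. p i) \<in> rat_polys n"
  by (induction I rule: infinite_finite_induct) (simp_all add: rat_polys_one rat_polys_mult)

section \<open>Right translates and invariance on generated algebras\<close>

lemma r_coset_eq_image: "S #>\<^bsub>G\<^esub> w = (\<lambda>s. s \<otimes>\<^bsub>G\<^esub> w) ` S"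
  unfolding r_coset_def by blast

lemma (in group) inj_on_mult_right: "w \<in> carrier G \<Longrightarrow> S \<subseteq> carrier G \<Longrightarrow> inj_on (\<lambda>s. s \<otimes> w) S"
  by (meson inj_onI right_cancel subsetD)

lemma (in group) r_coset_Diff:
  assumes "w \<in> carrier G" "S \<subseteq> carrier G" "T \<subseteq> carrier G"
  shows "(S - T) #> w = (S #> w) - (T #> w)"
  unfolding r_coset_eq_image
  using assms by (intro inj_on_image_set_diff[OF inj_on_mult_right]) auto

lemma (in group) r_coset_Int:
  assumes "w \<in> carrier G" "S \<subseteq> carrier G" "T \<subseteq> carrier G"
  shows "(S \<inter> T) #> w = (S #> w) \<inter> (T #> w)"
  unfolding r_coset_eq_image
  using assms by (intro inj_on_image_Int[OF inj_on_mult_right]) auto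

lemma r_coset_Un: "(S \<union> T) #>\<^bsub>G\<^esub> w = (S #>\<^bsub>G\<^esub> w) \<union> (T #>\<^bsub>G\<^esub> w)"
  unfolding r_coset_eq_image by blast

lemma (in group) carrier_r_coset: "w \<in> carrier G \<Longrightarrow> carrier G #> w = carrier G"
  using coset_join2 subgroup_self by blast

lemma r_coset_product_group:
  "(\<Pi>\<^sub>E i\<in>I. C i) #>\<^bsub>product_group I G\<^esub> w = (\<Pi>\<^sub>E i\<in>I. C i #>\<^bsub>G i\<^esub> w i)"
proof
  show "(\<Pi>\<^sub>E i\<in>I. C i) #>\<^bsub>product_group I G\<^esub> w \<subseteq> (\<Pi>\<^sub>E i\<in>I. C i #>\<^bsub>G i\<^esub> w i)"
    unfolding r_coset_eq_image by auto
  show "(\<Pi>\<^sub>E i\<in>I. C i #>\<^bsub>G i\<^esub> w i) \<subseteq> (\<Pi>\<^sub>E i\<in>I. C i) #>\<^bsub>product_group I G\<^esub> w"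
  proof
    fix y assume y: "y \<in> (\<Pi>\<^sub>E i\<in>I. C i #>\<^bsub>G i\<^esub> w i)"
    then have "\<forall>i\<in>I. \<exists>c. c \<in> C i \<and> y i = c \<otimes>\<^bsub>G i\<^esub> w i"
      unfolding r_coset_eq_image by (auto dest: PiE_mem)
    then obtain c where c: "\<forall>i\<in>I. c i \<in> C i \<and> y i = c i \<otimes>\<^bsub>G i\<^esub> w i"
      by metis
    have "y = (\<lambda>i\<in>I. restrict c I i \<otimes>\<^bsub>G i\<^esub> w i)"
      using y c by (intro extensionalityI[of _ I]) (auto simp: PiE_def)
    then show "y \<in> (\<Pi>\<^sub>E i\<in>I. C i) #>\<^bsub>product_group I G\<^esub> w"
      unfolding r_coset_eq_image using c by (intro image_eqI[of _ _ "restrict c I"]) auto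
  qed
qed

lemma generated_boolean_algebra_translate:
  fixes G (structure)
  assumes "group G" and w: "w \<in> carrier G"
    and gen: "\<And>S. S \<in> \<G> \<Longrightarrow> S #>\<^bsub>G\<^esub> w \<in> \<G>" and sub: "\<Union>\<G> \<subseteq> carrier G"
    and "S \<in> generated_boolean_algebra (carrier G) \<G>"
  shows "S #>\<^bsub>G\<^esub> w \<in> generated_boolean_algebra (carrier G) \<G>"
  using assms(5)
proof induction
  interpret group G by fact
  case (compl S)
  have "(carrier G - S) #> w = carrier G - (S #> w)"
    using r_coset_Diff[OF w subset_refl generated_boolean_algebra_subset[OF compl.hyps sub]]
      carrier_r_coset[OF w] by simp
  then show ?case using compl.IH by (simp add: generated_boolean_algebra.compl)
qed (use gen in \<open>auto simp: r_coset_Un r_coset_def intro: generated_boolean_algebra.intros\<close>)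

text \<open>Right multiplication is injective, so translation commutes with differences, unions and
  intersections, and invariance on the generators propagates through the valuation
  identities.\<close>

lemma translation_invariant_onI:
  fixes G (structure) and f :: "'a set \<Rightarrow> 'r::ab_group_add"
  assumes "group G" and val: "valuation_on (generated_boolean_algebra (carrier G) \<G>) f"
    and sub: "\<Union>\<G> \<subseteq> carrier G" and top: "carrier G \<in> \<G>"
    and inter: "\<forall>S\<in>\<G>. \<forall>T\<in>\<G>. S \<inter> T \<in> insert {} \<G>"
    and gen: "\<And>S w. S \<in> \<G> \<Longrightarrow> w \<in> carrier G \<Longrightarrow> S #>\<^bsub>G\<^esub> w \<in> \<G> \<and> f (S #>\<^bsub>G\<^esub> w) = f S"
  shows "translation_invariant_on G (generated_boolean_algebra (carrier G) \<G>) f"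
  unfolding translation_invariant_on_def
proof (intro ballI)
  interpret group G by fact
  fix S w assume S: "S \<in> generated_boolean_algebra (carrier G) \<G>" and w: "w \<in> carrier G"
  have sub': "S \<subseteq> carrier G" if "S \<in> generated_boolean_algebra (carrier G) \<G>" for S
    using generated_boolean_algebra_subset[OF that sub] .
  have tr: "S #> w \<in> generated_boolean_algebra (carrier G) \<G>"
    if "S \<in> generated_boolean_algebra (carrier G) \<G>" for S
    using generated_boolean_algebra_translate[OF \<open>group G\<close> w _ sub that] gen w by blast
  show "f (S #> w) = f S"
    using S sub top inter
  proof (induction rule: generated_boolean_algebra_pi_induct)
    case empty
    then show ?case by (simp add: r_coset_eq_image)
  next
    case (generator S)
    then show ?case using gen w by blast
  next
    case (diff S T)
    have "S #> w \<subseteq> T #> w" using \<open>S \<subseteq> T\<close> unfolding r_coset_eq_image by blast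
    then show ?case
      using diff tr valuation_on_Diff[OF val sub]
      by (simp add: r_coset_Diff[OF w sub'[OF diff.hyps(2)] sub'[OF diff.hyps(1)]])
  next
    case (union S T)
    then show ?case
      using tr valuation_on_Un[OF val]
      by (simp add: r_coset_Un r_coset_Int[OF w sub'[OF union.hyps(1)] sub'[OF union.hyps(2)]])
  qed
qed

text \<open>Brings the indicator of a box into the shape in which \<open>tensor_relation\<close>
  takes its hypothesis.\<close>

lemma PiE_of_bool:
  assumes "finite I" "y \<in> extensional I"
  shows "(of_bool (y \<in> (\<Pi>\<^sub>E i\<in>I. C i)) :: 'r::comm_semiring_1) = (\<Prod>i\<in>I. of_bool (y i \<in> C i))"
proof -
  have "(\<Prod>i\<in>I. of_bool (y i \<in> C i) :: 'r) = of_bool (\<forall>i\<in>I. y i \<in> C i)"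
    using assms(1) by induction auto
  moreover have "y \<in> (\<Pi>\<^sub>E i\<in>I. C i) \<longleftrightarrow> (\<forall>i\<in>I. y i \<in> C i)"
    using assms(2) by (auto simp: PiE_def)
  ultimately show ?thesis by simp
qed


section \<open>Products of cosets and their weights\<close>

definition coset_product :: "'i set \<Rightarrow> ('i \<Rightarrow> ('a, 'b) monoid_scheme) \<Rightarrow> ('i \<Rightarrow> 'a set) \<times> ('i \<Rightarrow> 'a) \<Rightarrow> ('i \<Rightarrow> 'a) set"
  where "coset_product I G = (\<lambda>(A, x). \<Pi>\<^sub>E i\<in>I. A i #>\<^bsub>G i\<^esub> x i)"

text \<open>The common core of the two cases. Torsion, rank and dimension enter only through
  \<open>weight_index\<close> and \<open>weight_poly\<close>.\<close>

locale indexed_coset_weights =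
  fixes n :: nat and G :: "nat \<Rightarrow> ('a, 'b) monoid_scheme" and Sub :: "nat \<Rightarrow> 'a set set"
    and \<mu> :: "nat \<Rightarrow> 'a set \<Rightarrow> rat_mpoly"
  assumes G: "i \<in> {1..n} \<Longrightarrow> group (G i)"
    and Sub: "\<lbrakk>i \<in> {1..n}; A \<in> Sub i\<rbrakk> \<Longrightarrow> subgroup A (G i)"
    and Sub_top: "i \<in> {1..n} \<Longrightarrow> carrier (G i) \<in> Sub i"
    and Sub_Int: "\<lbrakk>i \<in> {1..n}; A \<in> Sub i; B \<in> Sub i\<rbrakk> \<Longrightarrow> A \<inter> B \<in> Sub i"
    and weight_index: "\<lbrakk>i \<in> {1..n}; A \<in> Sub i; B \<in> Sub i; B \<subseteq> A; virtually_contained (G i) A B\<rbrakk>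
          \<Longrightarrow> \<mu> i A = of_nat (card ((\<lambda>a. B #>\<^bsub>G i\<^esub> a) ` A)) * \<mu> i B"
    and weight_poly: "\<lbrakk>i \<in> {1..n}; A \<in> Sub i\<rbrakk> \<Longrightarrow> \<mu> i A \<in> rat_polys n"
begin

abbreviation "P \<equiv> product_group {1..n} G"

text \<open>Coset data rather than sets, because the weight reads the subgroups. A set has many
  codes: representatives may vary within their cosets, and nothing is fixed outside
  \<open>{1..n}\<close>.\<close>

definition codes :: "((nat \<Rightarrow> 'a set) \<times> (nat \<Rightarrow> 'a)) set" where
  "codes = {(A, x). \<forall>i\<in>{1..n}. A i \<in> Sub i \<and> x i \<in> carrier (G i)}"

abbreviation "st \<equiv> coset_product {1..n} G"

lemma coset_product_algebra_codes:
  "coset_product_algebra n G Sub = generated_boolean_algebra (carrier P) (st ` codes)"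
proof -
  have "{\<Pi>\<^sub>E i\<in>{1..n}. C i | C. \<forall>i\<in>{1..n}. \<exists>A\<in>Sub i. C i \<in> rcosets\<^bsub>G i\<^esub> A} = st ` codes"
  proof safe
    fix C assume "\<forall>i\<in>{1..n}. \<exists>A\<in>Sub i. C i \<in> rcosets\<^bsub>G i\<^esub> A"
    then have "\<forall>i\<in>{1..n}. \<exists>A x. A \<in> Sub i \<and> x \<in> carrier (G i) \<and> C i = A #>\<^bsub>G i\<^esub> x"
      unfolding RCOSETS_def by blast
    then obtain A x where
      "\<forall>i\<in>{1..n}. A i \<in> Sub i \<and> x i \<in> carrier (G i) \<and> C i = A i #>\<^bsub>G i\<^esub> x i"
      by metis
    then have "(A, x) \<in> codes" "st (A, x) = (\<Pi>\<^sub>E i\<in>{1..n}. C i)"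
      unfolding codes_def coset_product_def by (auto intro!: PiE_cong)
    then show "(\<Pi>\<^sub>E i\<in>{1..n}. C i) \<in> st ` codes" by (metis imageI)
  next
    fix A x assume "(A, x) \<in> codes"
    then show "\<exists>C. st (A, x) = (\<Pi>\<^sub>E i\<in>{1..n}. C i) \<and> (\<forall>i\<in>{1..n}. \<exists>A\<in>Sub i. C i \<in> rcosets\<^bsub>G i\<^esub> A)"
      unfolding codes_def coset_product_def RCOSETS_def
      by (intro exI[of _ "\<lambda>i. A i #>\<^bsub>G i\<^esub> x i"]) auto
  qed
  then show ?thesis unfolding coset_product_algebra_def by simp
qed

lemma group_P: "group P"
  using G by (rule product_group)

lemma codes_subset: "\<Union>(st ` codes) \<subseteq> carrier P"
proof -
  have "A i #>\<^bsub>G i\<^esub> x i \<subseteq> carrier (G i)" if "(A, x) \<in> codes" "i \<in> {1..n}" for A x i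
  proof -
    interpret group "G i" by (rule G[OF that(2)])
    show ?thesis
      using that r_coset_subset_G[OF subgroup.subset[OF Sub[OF that(2)]]] unfolding codes_def by blast
  qed
  then show ?thesis
    unfolding coset_product_def by (fastforce simp: PiE_iff)
qed

lemma st_one:
  assumes "\<And>i. i \<in> {1..n} \<Longrightarrow> A i \<in> Sub i"
  shows "(A, \<lambda>i. \<one>\<^bsub>G i\<^esub>) \<in> codes" "st (A, \<lambda>i. \<one>\<^bsub>G i\<^esub>) = (\<Pi>\<^sub>E i\<in>{1..n}. A i)"
proof -
  have "A i #>\<^bsub>G i\<^esub> \<one>\<^bsub>G i\<^esub> = A i" "\<one>\<^bsub>G i\<^esub> \<in> carrier (G i)" if "i \<in> {1..n}" for i
  proof -
    interpret group "G i" by (rule G[OF that])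
    show "A i #>\<^bsub>G i\<^esub> \<one>\<^bsub>G i\<^esub> = A i" "\<one>\<^bsub>G i\<^esub> \<in> carrier (G i)"
      using coset_mult_one[OF subgroup.subset[OF Sub[OF that assms[OF that]]]] by simp_all
  qed
  then show "(A, \<lambda>i. \<one>\<^bsub>G i\<^esub>) \<in> codes" "st (A, \<lambda>i. \<one>\<^bsub>G i\<^esub>) = (\<Pi>\<^sub>E i\<in>{1..n}. A i)"
    using assms unfolding codes_def coset_product_def by (auto intro!: PiE_cong)
qed

lemma codes_top: "carrier P \<in> st ` codes"
  using st_one[of "\<lambda>i. carrier (G i)"] Sub_top by (metis carrier_product_group imageI)

text \<open>A point common to two products of cosets serves in every coordinate as a representative
  for both, so their intersection is a product of cosets of the subgroups
  \<open>A i \<inter> B i\<close>.\<close>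

lemma codes_Int: "\<forall>S\<in>st ` codes. \<forall>T\<in>st ` codes. S \<inter> T \<in> insert {} (st ` codes)"
proof (intro ballI)
  fix S T assume "S \<in> st ` codes" "T \<in> st ` codes"
  then obtain A x B y where c: "(A, x) \<in> codes" "(B, y) \<in> codes" and ST: "S = st (A, x)" "T = st (B, y)"
    by force
  show "S \<inter> T \<in> insert {} (st ` codes)"
  proof (cases "S \<inter> T = {}")
    case True
    then show ?thesis by simp
  next
    case False
    then obtain z where z: "z \<in> S" "z \<in> T" by blast
    have step: "(A i #>\<^bsub>G i\<^esub> x i) \<inter> (B i #>\<^bsub>G i\<^esub> y i) = (A i \<inter> B i) #>\<^bsub>G i\<^esub> z i \<and> z i \<in> carrier (G i)"
      if i: "i \<in> {1..n}" for i
    proof -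
      interpret group "G i" by (rule G[OF i])
      have sub: "subgroup (A i) (G i)" "subgroup (B i) (G i)" "x i \<in> carrier (G i)" "y i \<in> carrier (G i)"
        using c i Sub[OF i] unfolding codes_def by auto
      have zi: "z i \<in> A i #>\<^bsub>G i\<^esub> x i" "z i \<in> B i #>\<^bsub>G i\<^esub> y i"
        using z i unfolding ST coset_product_def by (auto simp: PiE_iff)
      show ?thesis
        using rcosets_Int[OF sub] zi mem_rcoset_iff[OF sub(1,3)] by blast
    qed
    have "S \<inter> T = (\<Pi>\<^sub>E i\<in>{1..n}. (A i #>\<^bsub>G i\<^esub> x i) \<inter> (B i #>\<^bsub>G i\<^esub> y i))"
      unfolding ST coset_product_def by (simp add: PiE_Int)
    also have "\<dots> = st (\<lambda>i. A i \<inter> B i, z)"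
      unfolding coset_product_def prod.case by (rule PiE_cong) (use step in blast)
    finally have "S \<inter> T = st (\<lambda>i. A i \<inter> B i, z)" .
    moreover have "(\<lambda>i. A i \<inter> B i, z) \<in> codes"
      using step c Sub_Int unfolding codes_def by blast
    ultimately show ?thesis by blast
  qed
qed

text \<open>Only the representatives move; as the weight depends on the subgroups alone, invariance
  on the generators follows at once.\<close>

lemma st_translate:
  assumes c: "(A, x) \<in> codes" and w: "w \<in> carrier P"
  shows "st (A, x) #>\<^bsub>P\<^esub> w = st (A, \<lambda>i. x i \<otimes>\<^bsub>G i\<^esub> w i)" "(A, \<lambda>i. x i \<otimes>\<^bsub>G i\<^esub> w i) \<in> codes"
proof -
  have "(A i #>\<^bsub>G i\<^esub> x i) #>\<^bsub>G i\<^esub> w i = A i #>\<^bsub>G i\<^esub> (x i \<otimes>\<^bsub>G i\<^esub> w i) \<and> x i \<otimes>\<^bsub>G i\<^esub> w i \<in> carrier (G i)"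
    if i: "i \<in> {1..n}" for i
  proof -
    interpret group "G i" by (rule G[OF i])
    have "A i \<subseteq> carrier (G i)" "x i \<in> carrier (G i)" "w i \<in> carrier (G i)"
      using c w i subgroup.subset[OF Sub[OF i]] unfolding codes_def by auto
    then show ?thesis by (simp add: coset_mult_assoc)
  qed
  then show "st (A, x) #>\<^bsub>P\<^esub> w = st (A, \<lambda>i. x i \<otimes>\<^bsub>G i\<^esub> w i)" "(A, \<lambda>i. x i \<otimes>\<^bsub>G i\<^esub> w i) \<in> codes"
    using c unfolding codes_def coset_product_def
    by (auto simp: r_coset_product_group intro!: PiE_cong)
qed

lemma weight_relation:
  assumes xs: "snd ` set xs \<subseteq> codes"
    and rel: "\<And>y. y \<in> carrier P \<Longrightarrow> (\<Sum>(r, c)\<leftarrow>xs. r * of_bool (y \<in> st c)) = 0"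
  shows "(\<Sum>(r, c)\<leftarrow>xs. r * (\<Prod>i=1..n. \<mu> i (fst c i))) = 0"
proof -
  \<comment> \<open>Indexing by list positions keeps repeated terms apart.\<close>
  define J where "J = {..<length xs}"
  define r where "r j = fst (xs ! j)" for j
  define A where "A j = fst (snd (xs ! j))" for j
  define x where "x j = snd (snd (xs ! j))" for j
  have sum_xs: "(\<Sum>(r, c)\<leftarrow>xs. r * f c) = (\<Sum>j\<in>J. r j * f (A j, x j))" for f :: "_ \<Rightarrow> rat_mpoly"
    unfolding J_def r_def A_def x_def by (simp add: sum_list_sum_nth split_def atLeast0LessThan)
  have c: "A j i \<in> Sub i" "x j i \<in> carrier (G i)" if "j \<in> J" "i \<in> {1..n}" for i j
  proof -
    have "(A j, x j) \<in> codes" using xs \<open>j \<in> J\<close> unfolding J_def A_def x_def by force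
    then show "A j i \<in> Sub i" "x j i \<in> carrier (G i)" using that(2) unfolding codes_def by auto
  qed
  have "(\<Sum>j\<in>J. r j * (\<Prod>i\<in>{1..n}. \<mu> i (A j i))) = 0"
  proof (rule tensor_relation[where U = "\<lambda>i. carrier (G i)" and C = "\<lambda>i j. A j i #>\<^bsub>G i\<^esub> x j i"])
    fix i and s :: "nat \<Rightarrow> rat_mpoly"
    assume i: "i \<in> {1..n}"
      and s: "\<And>z. z \<in> carrier (G i) \<Longrightarrow> (\<Sum>j\<in>J. s j * of_bool (z \<in> A j i #>\<^bsub>G i\<^esub> x j i)) = 0"
    interpret group "G i" by (rule G[OF i])
    show "(\<Sum>j\<in>J. s j * \<mu> i (A j i)) = 0"
    proof (rule coset_relation[where Sub = "Sub i" and A = "\<lambda>j. A j i" and x = "\<lambda>j. x j i"])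
      show "finite J" unfolding J_def by simp
    qed (use i c s Sub Sub_Int weight_index in auto)
  next
    fix y assume y: "\<And>i. i \<in> {1..n} \<Longrightarrow> y i \<in> carrier (G i)"
    \<comment> \<open>Elements of the product group are extensional, while the coordinatewise
      argument runs over arbitrary tuples.\<close>
    let ?y = "restrict y {1..n}"
    have "?y \<in> carrier P" using y by simp
    then have "(\<Sum>j\<in>J. r j * of_bool (?y \<in> st (A j, x j))) = 0"
      using rel sum_xs[of "\<lambda>c. of_bool (?y \<in> st c)"] by simp
    moreover have "(of_bool (?y \<in> st (A j, x j)) :: rat_mpoly) =
        (\<Prod>i\<in>{1..n}. of_bool (y i \<in> A j i #>\<^bsub>G i\<^esub> x j i))" for j
      unfolding coset_product_def prod.case by (subst PiE_of_bool) (auto intro!: prod.cong)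
    ultimately show "(\<Sum>j\<in>J. r j * (\<Prod>i\<in>{1..n}. of_bool (y i \<in> A j i #>\<^bsub>G i\<^esub> x j i))) = 0"
      by simp
  qed simp
  then show ?thesis using sum_xs[of "\<lambda>c. \<Prod>i=1..n. \<mu> i (fst c i)"] by simp
qed

theorem ex1_translation_invariant_valuation:
  "\<exists>!val. val \<in> coset_product_algebra n G Sub \<rightarrow>\<^sub>E rat_polys n
      \<and> valuation_on (coset_product_algebra n G Sub) val
      \<and> translation_invariant_on P (coset_product_algebra n G Sub) val
      \<and> (\<forall>A. (\<forall>i\<in>{1..n}. A i \<in> Sub i) \<longrightarrow> val (\<Pi>\<^sub>E i\<in>{1..n}. A i) = (\<Prod>i=1..n. \<mu> i (A i)))"
proof (rule ex_ex1I)
  let ?B = "generated_boolean_algebra (carrier P) (st ` codes)"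
  note B = generated_boolean_algebra.intros[where X = "carrier P" and \<G> = "st ` codes"]
  obtain f where f: "valuation_on ?B f" "\<And>c. c \<in> codes \<Longrightarrow> f (st c) = (\<Prod>i=1..n. \<mu> i (fst c i))"
    using valuation_extension[OF codes_subset codes_top codes_Int weight_relation] by blast
  \<comment> \<open>Off the algebra the value is fixed to \<open>undefined\<close>, as
    \<open>\<rightarrow>\<^sub>E\<close> demands; this makes uniqueness of a total function
    possible.\<close>
  define val where "val = restrict f ?B"
  have valuation: "valuation_on ?B val"
    using f(1) B generated_boolean_algebra_Int[OF _ _ codes_subset]
    unfolding valuation_on_def val_def by simp
  have st: "val (st c) = (\<Prod>i=1..n. \<mu> i (fst c i))" if "c \<in> codes" for c
    using f(2)[OF that] that B(1) unfolding val_def by simp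
  \<comment> \<open>The ambient type has infinitely many indeterminates, so confinement of the
    values to the first \<open>n\<close> needs its own induction.\<close>
  have "f S \<in> rat_polys n" if "S \<in> ?B" for S
    using that codes_subset codes_top codes_Int
  proof (induction rule: generated_boolean_algebra_pi_induct)
    case empty
    then show ?case using f(1) unfolding valuation_on_def rat_polys_def by simp
  next
    case (generator S)
    then obtain A x where c: "(A, x) \<in> codes" "S = st (A, x)" by force
    then have "\<mu> i (A i) \<in> rat_polys n" if "i \<in> {1..n}" for i
      using weight_poly[OF that] that unfolding codes_def by blast
    then have "(\<Prod>i=1..n. \<mu> i (A i)) \<in> rat_polys n" by (rule rat_polys_prod)
    then show ?case using f(2) c by simp
  next
    case (diff S T)
    then show ?case using valuation_on_Diff[OF f(1) codes_subset] rat_polys_diff by simp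
  next
    case (union S T)
    then show ?case using valuation_on_Un[OF f(1)] rat_polys_add rat_polys_diff by simp
  qed
  then have "val \<in> ?B \<rightarrow>\<^sub>E rat_polys n" unfolding val_def by auto
  moreover have "translation_invariant_on P ?B val"
  proof (rule translation_invariant_onI[OF group_P valuation codes_subset codes_top codes_Int])
    fix S w assume "S \<in> st ` codes" and w: "w \<in> carrier P"
    then obtain A x where c: "(A, x) \<in> codes" "S = st (A, x)" by force
    show "S #>\<^bsub>P\<^esub> w \<in> st ` codes \<and> val (S #>\<^bsub>P\<^esub> w) = val S"
      using imageI[OF st_translate(2)[OF c(1) w], of st]
      by (simp only: c(2) st_translate(1)[OF c(1) w] st[OF c(1)] st[OF st_translate(2)[OF c(1) w]] fst_conv)
  qed
  moreover have "val (\<Pi>\<^sub>E i\<in>{1..n}. A i) = (\<Prod>i=1..n. \<mu> i (A i))" if "\<forall>i\<in>{1..n}. A i \<in> Sub i" for A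
    using st_one(2)[of A] st[OF st_one(1)[of A]] that by simp
  ultimately show "\<exists>val. val \<in> coset_product_algebra n G Sub \<rightarrow>\<^sub>E rat_polys n
      \<and> valuation_on (coset_product_algebra n G Sub) val
      \<and> translation_invariant_on P (coset_product_algebra n G Sub) val
      \<and> (\<forall>A. (\<forall>i\<in>{1..n}. A i \<in> Sub i) \<longrightarrow> val (\<Pi>\<^sub>E i\<in>{1..n}. A i) = (\<Prod>i=1..n. \<mu> i (A i)))"
    using valuation unfolding coset_product_algebra_codes by blast
next
  let ?B = "generated_boolean_algebra (carrier P) (st ` codes)"
  \<comment> \<open>Every product of cosets is a translate of a product of subgroups, where the
    value is prescribed; invariance thus determines the value on all generators.\<close>
  have val_st: "h (st (A, x)) = (\<Prod>i=1..n. \<mu> i (A i))"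
    if inv: "translation_invariant_on P ?B h"
      and eq: "\<forall>A. (\<forall>i\<in>{1..n}. A i \<in> Sub i) \<longrightarrow> h (\<Pi>\<^sub>E i\<in>{1..n}. A i) = (\<Prod>i=1..n. \<mu> i (A i))"
      and c: "(A, x) \<in> codes" for h :: "_ \<Rightarrow> rat_mpoly" and A x
  proof -
    have A: "\<And>i. i \<in> {1..n} \<Longrightarrow> A i \<in> Sub i" and x: "restrict x {1..n} \<in> carrier P"
      using c unfolding codes_def by auto
    have "st (A, \<lambda>i. \<one>\<^bsub>G i\<^esub>) #>\<^bsub>P\<^esub> restrict x {1..n} = st (A, x)"
    proof -
      have "\<one>\<^bsub>G i\<^esub> \<otimes>\<^bsub>G i\<^esub> x i = x i" if "i \<in> {1..n}" for i
        using monoid.l_one[OF group.is_monoid[OF G[OF that]]] c that unfolding codes_def by auto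
      then have "st (A, \<lambda>i. \<one>\<^bsub>G i\<^esub> \<otimes>\<^bsub>G i\<^esub> restrict x {1..n} i) = st (A, x)"
        unfolding coset_product_def prod.case by (intro PiE_cong) simp
      then show ?thesis
        using st_translate(1)[OF st_one(1)[OF A] x] by simp
    qed
    moreover have "st (A, \<lambda>i. \<one>\<^bsub>G i\<^esub>) \<in> ?B"
      using st_one(1)[OF A] by (intro generated_boolean_algebra.generator imageI)
    ultimately have "h (st (A, x)) = h (st (A, \<lambda>i. \<one>\<^bsub>G i\<^esub>))"
      using inv x unfolding translation_invariant_on_def by metis
    then show ?thesis using eq A st_one(2)[OF A] by simp
  qed
  fix v w
  assume v: "v \<in> coset_product_algebra n G Sub \<rightarrow>\<^sub>E rat_polys n
      \<and> valuation_on (coset_product_algebra n G Sub) v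
      \<and> translation_invariant_on P (coset_product_algebra n G Sub) v
      \<and> (\<forall>A. (\<forall>i\<in>{1..n}. A i \<in> Sub i) \<longrightarrow> v (\<Pi>\<^sub>E i\<in>{1..n}. A i) = (\<Prod>i=1..n. \<mu> i (A i)))"
    and w: "w \<in> coset_product_algebra n G Sub \<rightarrow>\<^sub>E rat_polys n
      \<and> valuation_on (coset_product_algebra n G Sub) w
      \<and> translation_invariant_on P (coset_product_algebra n G Sub) w
      \<and> (\<forall>A. (\<forall>i\<in>{1..n}. A i \<in> Sub i) \<longrightarrow> w (\<Pi>\<^sub>E i\<in>{1..n}. A i) = (\<Prod>i=1..n. \<mu> i (A i)))"
  note v = v[unfolded coset_product_algebra_codes] and w = w[unfolded coset_product_algebra_codes]
  have "v S = w S" if S: "S \<in> st ` codes" for S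
  proof -
    obtain A x where c: "(A, x) \<in> codes" "S = st (A, x)" using S by force
    have "v S = (\<Prod>i=1..n. \<mu> i (A i))"
      unfolding c(2) by (rule val_st[OF _ _ c(1)]) (use v in blast)+
    moreover have "w S = (\<Prod>i=1..n. \<mu> i (A i))"
      unfolding c(2) by (rule val_st[OF _ _ c(1)]) (use w in blast)+
    ultimately show ?thesis by simp
  qed
  then have "v S = w S" if "S \<in> ?B" for S
    using valuation_on_eqI[OF _ _ codes_subset codes_top codes_Int _ that] v w by blast
  then show "v = w" using v w by (blast intro: PiE_ext)
qed

end

section \<open>Finitely generated abelian groups\<close>


context comm_group
begin

text \<open>Pigeonhole on the powers of \<open>x\<close>: two of them lie in the same coset of
  \<open>B\<close>, and their quotient is a positive power in \<open>B\<close>.\<close>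

lemma virtually_contained_pow:
  assumes "virtually_contained G A B" and A: "subgroup A G" and B: "subgroup B G" and x: "x \<in> A"
  shows "\<exists>m::nat. m > 0 \<and> x [^] m \<in> B"
proof -
  have xc: "x \<in> carrier G" using subgroup.mem_carrier[OF A x] .
  have pow: "x [^] (k::nat) \<in> A" for k
    using x subgroup.m_closed[OF A] subgroup.one_closed[OF A] by (induction k) auto
  have "finite (range (\<lambda>k::nat. B #> x [^] k))"
    using assms(1) pow unfolding virtually_contained_def
    by (elim finite_subset[rotated]) blast
  then have "\<not> inj (\<lambda>k::nat. B #> x [^] k)"
    using finite_imageD infinite_UNIV_nat by blast
  then obtain k l :: nat where kl: "k < l" "B #> x [^] k = B #> x [^] l"
    unfolding inj_on_def by (metis linorder_neqE_nat)
  have "x [^] l \<in> B #> x [^] k" using kl(2) rcos_self[OF _ B] xc by simp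
  then have "x [^] l \<otimes> inv (x [^] k) \<in> B" using mem_rcoset_iff[OF B] xc by simp
  moreover have "x [^] l = x [^] (l - k) \<otimes> x [^] k" using kl(1) xc by (simp add: nat_pow_mult)
  ultimately have "x [^] (l - k) \<in> B" using xc by (simp add: m_assoc)
  then show ?thesis using kl(1) by (meson zero_less_diff)
qed

section \<open>Torsion of a quotient as an index\<close>

lemma nat_pow_mem_subgroup: "subgroup B G \<Longrightarrow> x \<in> B \<Longrightarrow> x [^] (k::nat) \<in> B"
  by (induction k) (auto simp: subgroup.one_closed subgroup.m_closed)

text \<open>This set is the preimage of the torsion subgroup of the quotient by \<open>A\<close>.
  Commutativity gives closure under products, with the common exponent \<open>k * l\<close>.\<close>

lemma subgroup_roots:
  assumes A: "subgroup A G"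
  shows "subgroup {x \<in> carrier G. \<exists>m::nat. m > 0 \<and> x [^] m \<in> A} G"
proof (rule subgroupI)
  show "{x \<in> carrier G. \<exists>m::nat. m > 0 \<and> x [^] m \<in> A} \<noteq> {}"
    using subgroup.one_closed[OF A] by (auto intro!: exI[of _ \<one>] exI[of _ "1::nat"])
next
  fix x assume "x \<in> {x \<in> carrier G. \<exists>m::nat. m > 0 \<and> x [^] m \<in> A}"
  then obtain m :: nat where "x \<in> carrier G" "m > 0" "x [^] m \<in> A" by blast
  then show "inv x \<in> {x \<in> carrier G. \<exists>m::nat. m > 0 \<and> x [^] m \<in> A}"
    using subgroup.m_inv_closed[OF A, of "x [^] m"] by (auto simp: nat_pow_inv)
next
  fix x y
  assume "x \<in> {x \<in> carrier G. \<exists>m::nat. m > 0 \<and> x [^] m \<in> A}"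
    and "y \<in> {x \<in> carrier G. \<exists>m::nat. m > 0 \<and> x [^] m \<in> A}"
  then obtain k l :: nat where x: "x \<in> carrier G" "k > 0" "x [^] k \<in> A"
    and y: "y \<in> carrier G" "l > 0" "y [^] l \<in> A" by blast
  have "(x \<otimes> y) [^] (k * l) = (x [^] k) [^] l \<otimes> (y [^] l) [^] k"
    using x y by (simp add: nat_pow_distrib nat_pow_pow mult.commute)
  also have "\<dots> \<in> A"
    using nat_pow_mem_subgroup[OF A] x y subgroup.m_closed[OF A] by blast
  finally show "x \<otimes> y \<in> {x \<in> carrier G. \<exists>m::nat. m > 0 \<and> x [^] m \<in> A}"
    using x y by (auto intro!: exI[of _ "k * l"])
qed auto

lemma Tor_Mod:
  assumes A: "subgroup A G"
  shows "Tor (G Mod A) = (\<lambda>x. A #> x) ` {x \<in> carrier G. \<exists>m::nat. m > 0 \<and> x [^] m \<in> A}"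
proof -
  interpret normal A G using subgroup_imp_normal[OF A] .
  have "(A #> x) [^]\<^bsub>G Mod A\<^esub> m = A \<longleftrightarrow> x [^] m \<in> A" if x: "x \<in> carrier G" for x and m :: nat
    unfolding FactGroup_pow[OF x]
    using coset_join1[OF _ nat_pow_closed[OF x] A] coset_join2[OF nat_pow_closed[OF x] A] by blast
  then show ?thesis unfolding Tor_def by (auto simp: carrier_FactGroup)
qed

text \<open>An element with a positive power in \<open>A\<close> also has one in \<open>B\<close>,
  so both torsion subgroups consist of the cosets in one and the same group of roots, and the tower
  law in that group supplies the factor.\<close>

lemma card_Tor_Mod:
  assumes A: "subgroup A G" and B: "subgroup B G" and BA: "B \<subseteq> A" and vc: "virtually_contained G A B"
  shows "card (Tor (G Mod B)) = card (Tor (G Mod A)) * card ((\<lambda>x. B #> x) ` A)"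
proof -
  let ?T = "\<lambda>A. {x \<in> carrier G. \<exists>m::nat. m > 0 \<and> x [^] m \<in> A}"
  have "?T A \<subseteq> ?T B"
  proof
    fix x assume "x \<in> ?T A"
    then obtain m :: nat where x: "x \<in> carrier G" "m > 0" "x [^] m \<in> A" by blast
    then obtain k :: nat where "k > 0" "(x [^] m) [^] k \<in> B"
      using virtually_contained_pow[OF vc A B] by blast
    then show "x \<in> ?T B" using x by (auto simp: nat_pow_pow intro!: exI[of _ "m * k"])
  qed
  then have T: "?T B = ?T A" using BA by blast
  have "A \<subseteq> ?T A"
    using subgroup.mem_carrier[OF A] by (auto intro!: exI[of _ "1::nat"])
  then show ?thesis
    using card_rcosets_tower[OF subgroup_roots[OF A] A B BA] unfolding Tor_Mod[OF A] Tor_Mod[OF B] T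
    by simp
qed

section \<open>Rank under virtual containment\<close>

lemma subgroup_comm_group:
  assumes "subgroup A G"
  shows "comm_group (G\<lparr>carrier := A\<rparr>)"
  using subgroup.mem_carrier[OF assms] m_comm
  by (intro group.group_comm_groupI[OF subgroup_imp_group[OF assms]]) simp

lemma finprod_subgroup:
  assumes A: "subgroup A G" and "f \<in> S \<rightarrow> A"
  shows "finprod (G\<lparr>carrier := A\<rparr>) f S = finprod G f S"
proof -
  interpret H: comm_group "G\<lparr>carrier := A\<rparr>"
    using subgroup_comm_group[OF A] .
  show ?thesis
    using assms(2)
  proof (induction S rule: infinite_finite_induct)
    case (insert x S)
    then have "f \<in> S \<rightarrow> A" "f x \<in> A" by auto
    moreover from this have "f \<in> S \<rightarrow> carrier G" "f x \<in> carrier G"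
      using subgroup.subset[OF A] by auto
    ultimately show ?case using insert by simp
  qed simp_all
qed

text \<open>Ranks of different subgroups are computed in different groups; this moves them into the
  common ambient group, where independent sets can be compared.\<close>

lemma int_independent_subgroup:
  assumes A: "subgroup A G" and "S \<subseteq> A"
  shows "int_independent (G\<lparr>carrier := A\<rparr>) S \<longleftrightarrow> int_independent G S"
proof -
  have "finprod (G\<lparr>carrier := A\<rparr>) (\<lambda>x. x [^]\<^bsub>G\<lparr>carrier := A\<rparr>\<^esub> c x) S = finprod G (\<lambda>x. x [^] c x) S"
    for c :: "'a \<Rightarrow> int"
  proof -
    have *: "(\<lambda>x. x [^] c x) \<in> S \<rightarrow> A" using assms subgroup_int_pow_closed[OF A] by blast
    interpret H: comm_group "G\<lparr>carrier := A\<rparr>"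
      using subgroup_comm_group[OF A] .
    have "finprod (G\<lparr>carrier := A\<rparr>) (\<lambda>x. x [^]\<^bsub>G\<lparr>carrier := A\<rparr>\<^esub> c x) S =
        finprod (G\<lparr>carrier := A\<rparr>) (\<lambda>x. x [^] c x) S"
      using assms * int_pow_consistent[OF A] by (intro H.finprod_cong') auto
    then show ?thesis using finprod_subgroup[OF A *] by simp
  qed
  then show ?thesis unfolding int_independent_def by simp
qed

text \<open>A relation with exponents c among the powers is one with exponents m c among the
  elements. Injectivity ensures that the replacement keeps the cardinality, and has the same cause:
  two equal powers would be a nontrivial relation.\<close>

lemma int_independent_pow:
  fixes m :: "'a \<Rightarrow> nat"
  assumes S: "finite S" "S \<subseteq> carrier G" and ind: "int_independent G S"
    and m: "\<And>x. x \<in> S \<Longrightarrow> m x > 0"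
  shows "inj_on (\<lambda>x. x [^] m x) S" "int_independent G ((\<lambda>x. x [^] m x) ` S)"
proof -
  let ?f = "\<lambda>x. x [^] m x"
  show inj: "inj_on ?f S"
  proof (rule inj_onI, rule ccontr)
    fix x y assume xy: "x \<in> S" "y \<in> S" and eq: "?f x = ?f y" and ne: "x \<noteq> y"
    \<comment> \<open>The exponents of the relation x^(m x) y^(-(m y)) = 1 that equal powers would
      give.\<close>
    define c where "c z = (if z = x then int (m x) else if z = y then - int (m y) else 0)" for z
    let ?R = "S - {x, y}"
    have S_eq: "S = insert x (insert y ?R)" using xy by blast
    have car: "x \<in> carrier G" "y \<in> carrier G" using xy S by auto
    have clos: "(\<lambda>z. z [^] c z) \<in> T \<rightarrow> carrier G" if "T \<subseteq> S" for T
      using that S by (auto intro!: int_pow_closed)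
    have "finprod G (\<lambda>z. z [^] c z) ?R = \<one>"
      by (rule finprod_one_eqI) (auto simp: c_def)
    then have "finprod G (\<lambda>z. z [^] c z) (insert x (insert y ?R)) = x [^] c x \<otimes> (y [^] c y \<otimes> \<one>)"
      using S(1) car ne clos[of ?R] by (simp add: Pi_def)
    also have "\<dots> = ?f x \<otimes> inv (?f y)"
      using car ne by (simp add: c_def int_pow_int int_pow_neg_int)
    also have "\<dots> = \<one>" using eq car by simp
    finally have "finprod G (\<lambda>z. z [^] c z) S = \<one>" using S_eq by simp
    then have "c x = 0" using ind xy unfolding int_independent_def by blast
    then show False using m[OF xy(1)] by (simp add: c_def)
  qed
  show "int_independent G (?f ` S)"
    unfolding int_independent_def
  proof (intro allI impI)
    fix c :: "'a \<Rightarrow> int" assume prod: "finprod G (\<lambda>z. z [^] c z) (?f ` S) = \<one>"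
    have "finprod G (\<lambda>x. x [^] (int (m x) * c (?f x))) S = finprod G (\<lambda>x. ?f x [^] c (?f x)) S"
      using S by (intro finprod_cong') (auto simp: int_pow_pow simp flip: int_pow_int)
    also have "\<dots> = finprod G (\<lambda>z. z [^] c z) (?f ` S)"
      using S by (intro finprod_reindex[OF _ inj, symmetric]) auto
    finally have "finprod G (\<lambda>x. x [^] (int (m x) * c (?f x))) S = \<one>"
      unfolding prod .
    then have "\<forall>x\<in>S. int (m x) * c (?f x) = 0"
      using ind[unfolded int_independent_def, THEN spec, of "\<lambda>x. int (m x) * c (?f x)"] by blast
    then have "c (?f x) = 0" if "x \<in> S" for x using m[OF that] that by auto
    then show "\<forall>y\<in>?f ` S. c y = 0" by blast
  qed
qed

text \<open>Replacing each member of an independent subset of \<open>A\<close> by a positive power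
  in \<open>B\<close> keeps independence and cardinality, so both suprema run over the same set of
  numbers.\<close>

lemma group_rank_virtually_contained:
  assumes A: "subgroup A G" and B: "subgroup B G" and BA: "B \<subseteq> A" and vc: "virtually_contained G A B"
  shows "group_rank (G\<lparr>carrier := A\<rparr>) = group_rank (G\<lparr>carrier := B\<rparr>)"
proof -
  have rank: "group_rank (G\<lparr>carrier := A\<rparr>) = Sup {card S | S. finite S \<and> S \<subseteq> A \<and> int_independent G S}"
    if "subgroup A G" for A
    unfolding group_rank_def using int_independent_subgroup[OF that]
    by (intro arg_cong[where f = Sup]) auto
  have "\<exists>T. card S = card T \<and> finite T \<and> T \<subseteq> B \<and> int_independent G T"
    if S: "finite S" "S \<subseteq> A" "int_independent G S" for S
  proof -
    obtain m :: "'a \<Rightarrow> nat" where m: "\<And>x. x \<in> S \<Longrightarrow> m x > 0 \<and> x [^] m x \<in> B"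
      using virtually_contained_pow[OF vc A B] S(2) by (metis subsetD)
    have "S \<subseteq> carrier G" using S(2) subgroup.subset[OF A] by blast
    note pow = int_independent_pow[OF S(1) this S(3), of m]
    have "card S = card ((\<lambda>x. x [^] m x) ` S)" using card_image pow(1) m by fastforce
    then show ?thesis using pow(2) m S(1) by (intro exI[of _ "(\<lambda>x. x [^] m x) ` S"]) auto
  qed
  then have "{card S | S. finite S \<and> S \<subseteq> A \<and> int_independent G S} =
      {card S | S. finite S \<and> S \<subseteq> B \<and> int_independent G S}"
    using BA by blast
  then show ?thesis using rank A B by simp
qed

end

lemma of_nat_mult_Const: "of_nat k * Const c = Const (of_nat k * c)"
proof -
  have "(of_nat k :: rat_mpoly) = Const (of_nat k)"
    unfolding Const_def by (induction k) (auto simp: Poly_Mapping.single_add)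
  then have "of_nat k * Const c = Const (of_nat k) * Const c" by simp
  then show ?thesis unfolding Const_def Poly_Mapping.mult_single by simp
qed

lemma fg_weights:
  assumes "\<And>i. i \<in> {1..n} \<Longrightarrow> comm_group (\<Omega> i)"
  shows "indexed_coset_weights n \<Omega> (\<lambda>i. {A. subgroup A (\<Omega> i)})
    (\<lambda>i A. Const (of_nat (card (Tor (\<Omega> i))) / of_nat (card (Tor (\<Omega> i Mod A))))
      * Var i ^ group_rank (\<Omega> i\<lparr>carrier := A\<rparr>))"
proof (rule indexed_coset_weights.intro)
  fix i assume i: "i \<in> {1..n}"
  interpret comm_group "\<Omega> i" using assms[OF i] .
  show "group (\<Omega> i)" by unfold_locales
  show "carrier (\<Omega> i) \<in> {A. subgroup A (\<Omega> i)}" using subgroup_self by simp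
  show "subgroup A (\<Omega> i)" if "A \<in> {A. subgroup A (\<Omega> i)}" for A using that by simp
  show "A \<inter> B \<in> {A. subgroup A (\<Omega> i)}"
    if "A \<in> {A. subgroup A (\<Omega> i)}" "B \<in> {A. subgroup A (\<Omega> i)}" for A B
    using that subgroups_Inter_pair by simp
  show "Const (of_nat (card (Tor (\<Omega> i))) / of_nat (card (Tor (\<Omega> i Mod A))))
      * Var i ^ group_rank (\<Omega> i\<lparr>carrier := A\<rparr>) \<in> rat_polys n" for A
    using i by (intro rat_polys_mult rat_polys_Const rat_polys_power rat_polys_Var)
  fix A B assume "A \<in> {A. subgroup A (\<Omega> i)}" "B \<in> {A. subgroup A (\<Omega> i)}"
    and BA: "B \<subseteq> A" and vc: "virtually_contained (\<Omega> i) A B"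
  then have A: "subgroup A (\<Omega> i)" and B: "subgroup B (\<Omega> i)" by auto
  let ?k = "card ((\<lambda>a. B #>\<^bsub>\<Omega> i\<^esub> a) ` A)"
  have "A \<noteq> {}" using subgroup.one_closed[OF A] by blast
  \<comment> \<open>The index is about to be cancelled against the same factor in the denominator
    |Tor (\<Omega> / B)|.\<close>
  then have "?k \<noteq> 0" using vc unfolding virtually_contained_def by simp
  then have "of_nat (card (Tor (\<Omega> i))) / of_nat (card (Tor (\<Omega> i Mod A))) =
      of_nat ?k * (of_nat (card (Tor (\<Omega> i))) / of_nat (card (Tor (\<Omega> i Mod B))) :: rat)"
    unfolding card_Tor_Mod[OF A B BA vc] by simp
  then show "Const (of_nat (card (Tor (\<Omega> i))) / of_nat (card (Tor (\<Omega> i Mod A))))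
        * Var i ^ group_rank (\<Omega> i\<lparr>carrier := A\<rparr>) =
      of_nat ?k * (Const (of_nat (card (Tor (\<Omega> i))) / of_nat (card (Tor (\<Omega> i Mod B))))
        * Var i ^ group_rank (\<Omega> i\<lparr>carrier := B\<rparr>))"
    unfolding group_rank_virtually_contained[OF A B BA vc] mult.assoc[symmetric] of_nat_mult_Const
    by simp
qed

section \<open>Vector spaces over an infinite field\<close>

context vectorspace
begin

lemma subspace_imp_add_subgroup:
  assumes "subspace K W V"
  shows "subgroup W (add_monoid V)"
proof -
  interpret W: submodule K W V using is_module[OF assms] .
  show ?thesis
  proof
    fix x assume x: "x \<in> W"
    have "\<ominus>\<^bsub>K\<^esub> \<one>\<^bsub>K\<^esub> \<odot>\<^bsub>V\<^esub> x \<in> W" using W.smult_closed[OF _ x] by simp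
    then have "\<ominus>\<^bsub>V\<^esub> x \<in> W" using smult_minus_1 subsetD[OF W.subset x] by simp
    then show "inv\<^bsub>add_monoid V\<^esub> x \<in> W"
      unfolding a_inv_def .
  qed (use W.subset W.m_closed W.zero_closed in auto)
qed

lemma subspace_carrier: "subspace K (carrier V) V"
  by unfold_locales auto

lemma subspace_Int:
  assumes "subspace K A V" "subspace K B V"
  shows "subspace K (A \<inter> B) V"
proof -
  interpret A: submodule K A V using is_module[OF assms(1)] .
  interpret B: submodule K B V using is_module[OF assms(2)] .
  show ?thesis by unfold_locales (use A.subset in auto)
qed

text \<open>Over an infinite field the multiples of a vector outside a subspace lie in distinct cosets.\<close>

lemma virtually_contained_subspace:
  assumes "infinite (carrier K)" and A: "subspace K A V" and B: "subspace K B V"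
    and vc: "virtually_contained (add_monoid V) A B"
  shows "A \<subseteq> B"
proof
  interpret A: submodule K A V using is_module[OF A] .
  interpret B: submodule K B V using is_module[OF B] .
  note Bg = subspace_imp_add_subgroup[OF B]
  fix a assume a: "a \<in> A"
  have aV: "a \<in> carrier V" using a A.subset by blast
  show "a \<in> B"
  proof (rule ccontr)
    assume nB: "a \<notin> B"
    have "inj_on (\<lambda>k. B #>\<^bsub>add_monoid V\<^esub> (k \<odot>\<^bsub>V\<^esub> a)) (carrier K)"
    proof (rule inj_onI, rule ccontr)
      fix k l assume k: "k \<in> carrier K" and l: "l \<in> carrier K" and ne: "k \<noteq> l"
        and eq: "B #>\<^bsub>add_monoid V\<^esub> (k \<odot>\<^bsub>V\<^esub> a) = B #>\<^bsub>add_monoid V\<^esub> (l \<odot>\<^bsub>V\<^esub> a)"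
      have "k \<odot>\<^bsub>V\<^esub> a \<in> B #>\<^bsub>add_monoid V\<^esub> (l \<odot>\<^bsub>V\<^esub> a)"
        using eq group.rcos_self[OF a_group _ Bg, of "k \<odot>\<^bsub>V\<^esub> a"] k aV by simp
      then have "k \<odot>\<^bsub>V\<^esub> a \<oplus>\<^bsub>V\<^esub> (\<ominus>\<^bsub>V\<^esub> (l \<odot>\<^bsub>V\<^esub> a)) \<in> B"
        using group.mem_rcoset_iff[OF a_group Bg, of "l \<odot>\<^bsub>V\<^esub> a"] l aV unfolding a_inv_def by simp
      moreover have "k \<odot>\<^bsub>V\<^esub> a \<oplus>\<^bsub>V\<^esub> (\<ominus>\<^bsub>V\<^esub> (l \<odot>\<^bsub>V\<^esub> a)) = (k \<ominus>\<^bsub>K\<^esub> l) \<odot>\<^bsub>V\<^esub> a"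
        using k l aV by (simp add: smult_l_distr smult_l_minus R.minus_eq)
      ultimately have "(k \<ominus>\<^bsub>K\<^esub> l) \<odot>\<^bsub>V\<^esub> a \<in> B" by simp
      \<comment> \<open>A nonzero scalar of a field is invertible, so scaling back would put
        \<open>a\<close> itself into \<open>B\<close>.\<close>
      moreover have u: "k \<ominus>\<^bsub>K\<^esub> l \<in> Units K"
        using k l ne R.minus_other_side[OF k l] unfolding field_Units by auto
      ultimately have "inv\<^bsub>K\<^esub> (k \<ominus>\<^bsub>K\<^esub> l) \<odot>\<^bsub>V\<^esub> ((k \<ominus>\<^bsub>K\<^esub> l) \<odot>\<^bsub>V\<^esub> a) \<in> B"
        using B.smult_closed R.Units_inv_closed by blast
      moreover have "inv\<^bsub>K\<^esub> (k \<ominus>\<^bsub>K\<^esub> l) \<odot>\<^bsub>V\<^esub> ((k \<ominus>\<^bsub>K\<^esub> l) \<odot>\<^bsub>V\<^esub> a) = a"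
        using u aV k l by (simp add: R.Units_l_inv flip: smult_assoc1)
      ultimately show False using nB by simp
    qed
    \<comment> \<open>All multiples of \<open>a\<close> lie in \<open>A\<close>, which meets only
      finitely many cosets of \<open>B\<close>.\<close>
    moreover have "finite ((\<lambda>k. B #>\<^bsub>add_monoid V\<^esub> (k \<odot>\<^bsub>V\<^esub> a)) ` carrier K)"
      using vc A.smult_closed[OF _ a] unfolding virtually_contained_def
      by (elim finite_subset[rotated]) blast
    ultimately show False using assms(1) finite_imageD by blast
  qed
qed

end

text \<open>Torsion counts as trivial here, so the weight is a bare power of the variable; in
  positive characteristic the additive group itself would be all torsion. In the index formula the
  two subspaces coincide and the index is 1.\<close>

lemma vs_weights:
  assumes "infinite (carrier K)" and "\<And>i. i \<in> {1..n} \<Longrightarrow> vectorspace K (V i)"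
  shows "indexed_coset_weights n (\<lambda>i. add_monoid (V i)) (\<lambda>i. {A. subspace K A (V i)})
    (\<lambda>i A. Var i ^ vectorspace.dim K (V i\<lparr>carrier := A\<rparr>))"
proof (rule indexed_coset_weights.intro)
  fix i assume i: "i \<in> {1..n}"
  interpret vectorspace K "V i" using assms(2)[OF i] .
  show "group (add_monoid (V i))" using a_group .
  show "carrier (add_monoid (V i)) \<in> {A. subspace K A (V i)}" using subspace_carrier by simp
  show "subgroup A (add_monoid (V i))" if "A \<in> {A. subspace K A (V i)}" for A
    using that subspace_imp_add_subgroup by simp
  show "A \<inter> B \<in> {A. subspace K A (V i)}"
    if "A \<in> {A. subspace K A (V i)}" "B \<in> {A. subspace K A (V i)}" for A B
    using that subspace_Int by simp
  show "Var i ^ vectorspace.dim K (V i\<lparr>carrier := A\<rparr>) \<in> rat_polys n" for A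
    using i by (intro rat_polys_power rat_polys_Var)
  fix A B assume "A \<in> {A. subspace K A (V i)}" "B \<in> {A. subspace K A (V i)}"
    and BA: "B \<subseteq> A" and vc: "virtually_contained (add_monoid (V i)) A B"
  then have A: "subspace K A (V i)" and B: "subspace K B (V i)" by auto
  have AB: "A = B" using virtually_contained_subspace[OF assms(1) A B vc] BA by blast
  note Bg = subspace_imp_add_subgroup[OF B]
  have "(\<lambda>a. B #>\<^bsub>add_monoid (V i)\<^esub> a) ` B = {B}"
    using group.coset_join2[OF a_group subgroup.mem_carrier[OF Bg] Bg] subgroup.one_closed[OF Bg] by force
  then show "Var i ^ vectorspace.dim K (V i\<lparr>carrier := A\<rparr>) =
      of_nat (card ((\<lambda>a. B #>\<^bsub>add_monoid (V i)\<^esub> a) ` A)) * Var i ^ vectorspace.dim K (V i\<lparr>carrier := B\<rparr>)"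
    unfolding AB by simp
qed

theorem theorem2p2:
  fixes n :: nat
    and \<Omega> :: "nat \<Rightarrow> 'a monoid"
    and K :: "'k ring"
    and V :: "nat \<Rightarrow> ('k, 'v) module"
  shows
    "((\<forall>i\<in>{1..n}. comm_group (\<Omega> i) \<and> finitely_generated (\<Omega> i)) \<longrightarrow>
       (\<exists>!val. val \<in> fg_product_algebra n \<Omega> \<rightarrow>\<^sub>E rat_polys n
          \<and> valuation_on (fg_product_algebra n \<Omega>) val
          \<and> translation_invariant_on (product_group {1..n} \<Omega>) (fg_product_algebra n \<Omega>) val
          \<and> (\<forall>A. (\<forall>i\<in>{1..n}. subgroup (A i) (\<Omega> i)) \<longrightarrow>
                val (\<Pi>\<^sub>E i\<in>{1..n}. A i) =
                (\<Prod>i=1..n. Const (of_nat (card (Tor (\<Omega> i))) / of_nat (card (Tor (\<Omega> i Mod A i))))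
                          * Var i ^ group_rank (\<Omega> i\<lparr>carrier := A i\<rparr>)))))
   \<and> (field K \<and> infinite (carrier K)
        \<and> (\<forall>i\<in>{1..n}. vectorspace K (V i) \<and> vectorspace.fin_dim K (V i)) \<longrightarrow>
       (\<exists>!val. val \<in> vs_product_algebra n K V \<rightarrow>\<^sub>E rat_polys n
          \<and> valuation_on (vs_product_algebra n K V) val
          \<and> translation_invariant_on (product_group {1..n} (\<lambda>i. add_monoid (V i)))
              (vs_product_algebra n K V) val
          \<and> (\<forall>A. (\<forall>i\<in>{1..n}. VectorSpace.subspace K (A i) (V i)) \<longrightarrow>
                val (\<Pi>\<^sub>E i\<in>{1..n}. A i) =
                (\<Prod>i=1..n. Var i ^ vectorspace.dim K (V i\<lparr>carrier := A i\<rparr>)))))"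
proof (intro conjI impI)
  assume "\<forall>i\<in>{1..n}. comm_group (\<Omega> i) \<and> finitely_generated (\<Omega> i)"
  then have "indexed_coset_weights n \<Omega> (\<lambda>i. {A. subgroup A (\<Omega> i)})
    (\<lambda>i A. Const (of_nat (card (Tor (\<Omega> i))) / of_nat (card (Tor (\<Omega> i Mod A))))
      * Var i ^ group_rank (\<Omega> i\<lparr>carrier := A\<rparr>))"
    by (intro fg_weights) blast
  from indexed_coset_weights.ex1_translation_invariant_valuation[OF this]
  show "\<exists>!val. val \<in> fg_product_algebra n \<Omega> \<rightarrow>\<^sub>E rat_polys n
          \<and> valuation_on (fg_product_algebra n \<Omega>) val
          \<and> translation_invariant_on (product_group {1..n} \<Omega>) (fg_product_algebra n \<Omega>) val
          \<and> (\<forall>A. (\<forall>i\<in>{1..n}. subgroup (A i) (\<Omega> i)) \<longrightarrow>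
                val (\<Pi>\<^sub>E i\<in>{1..n}. A i) =
                (\<Prod>i=1..n. Const (of_nat (card (Tor (\<Omega> i))) / of_nat (card (Tor (\<Omega> i Mod A i))))
                          * Var i ^ group_rank (\<Omega> i\<lparr>carrier := A i\<rparr>)))"
    unfolding fg_product_algebra_def mem_Collect_eq .
next
  assume "field K \<and> infinite (carrier K)
        \<and> (\<forall>i\<in>{1..n}. vectorspace K (V i) \<and> vectorspace.fin_dim K (V i))"
  then have "indexed_coset_weights n (\<lambda>i. add_monoid (V i)) (\<lambda>i. {A. VectorSpace.subspace K A (V i)})
    (\<lambda>i A. Var i ^ vectorspace.dim K (V i\<lparr>carrier := A\<rparr>))"
    by (intro vs_weights) blast+
  from indexed_coset_weights.ex1_translation_invariant_valuation[OF this]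
  show "\<exists>!val. val \<in> vs_product_algebra n K V \<rightarrow>\<^sub>E rat_polys n
          \<and> valuation_on (vs_product_algebra n K V) val
          \<and> translation_invariant_on (product_group {1..n} (\<lambda>i. add_monoid (V i)))
              (vs_product_algebra n K V) val
          \<and> (\<forall>A. (\<forall>i\<in>{1..n}. VectorSpace.subspace K (A i) (V i)) \<longrightarrow>
                val (\<Pi>\<^sub>E i\<in>{1..n}. A i) =
                (\<Prod>i=1..n. Var i ^ vectorspace.dim K (V i\<lparr>carrier := A i\<rparr>)))"
    unfolding vs_product_algebra_def mem_Collect_eq .
qed

end
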